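(* Let $M$ be a von Neumann algebra, $D_t\subseteq B\subseteq M$ von Neumann subalgebras, $E_t:M\to D_t$ a faithful normal conditional expectation, and $R=R^*\in M$. Let $X:=R-E_t(R)$. Assume the conjugate variable $J_{D_t}(X:B)$ exists and that there is $K<\infty$ such that $$\Phi_{D_t}^{**}(X:B):=E_t\big(J_{D_t}(X:B)^*J_{D_t}(X:B)\big)\ \le\ K\,1_{D_t}.$$ Then for every self-adjoint $A\in D_t$, $$\mathrm{MSE}_t(A):=\big\|E_t((R-A)^2)\big\|\ \ge\ \frac1K .$$ In particular, even for the best predictor $A^\ast=E_t(R)$, $$\inf_{A=A^*\in D_t}\mathrm{MSE}_t(A)=\|E_t(X^2)\|\ \ge\ \frac1K .$$
   Context: Write $D=D_t$, $E_D=E_t$. $D$-valued inner product on $M$: $\langle x,y\rangle_D:=E_D(x^*y)$; $L^2_D(M)$ is the right Hilbert $C^*$-module over $D$ obtained by completing $M$ in $\|x\|_{2,D}:=\|E_D(x^*x)\|^{1/2}$. For $\xi,\eta\in L^2_D(M)$ write $E_D(\xi^*\eta):=\langle\xi,\eta\rangle_D$. $B\langle X\rangle\subseteq M$ is the unital $*$-algebra generated by $B$ and $X$, with closure $L^2_D(B\langle X\rangle)$ in $L^2_D(M)$. $X$ is assumed algebraically free from $B$ modulo $D$ (the canonical homomorphism into $M$ from the algebra of formal noncommutative polynomials in a self-adjoint indeterminate with coefficients in $B$, sending the indeterminate to $X$, is injective), so that the free difference quotient $\partial_{X:B}:B\langle X\rangle\to B\langle X\rangle\otimes_DB\langle X\rangle$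 is the well-defined $D$-bimodular derivation with $\partial_{X:B}(b)=0$ for $b\in B$ and $\partial_{X:B}(b_0Xb_1\cdots Xb_n)=\sum_{j=1}^n(b_0X\cdots Xb_{j-1})\otimes(b_jX\cdots Xb_n)$. On $B\langle X\rangle\otimes_DB\langle X\rangle$ use $\langle p_1\otimes q_1,p_2\otimes q_2\rangle_D:=E_D(q_1^*E_D(p_1^*p_2)q_2)$. The conjugate variable $J_D(X:B)=\partial_{X:B}^*(1\otimes1)$ exists if there is $J\in L^2_D(B\langle X\rangle)$ with $\langle J,p\rangle_D=\langle1\otimes1,\partial_{X:B}(p)\rangle_D$ for all $p\in B\langle X\rangle$; then $J_D(X:B):=J$. *)

theory Defs
  imports "HOL-Analysis.Analysis" "HOL-Library.Poly_Mapping"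
begin

section \<open>Complex Hilbert spaces and their bounded operators\<close>

class complex_vector = real_vector +
  fixes scaleC :: "complex \<Rightarrow> 'a \<Rightarrow> 'a"  (infixr "*\<^sub>C" 75)
  assumes scaleC_add_right: "c *\<^sub>C (x + y) = c *\<^sub>C x + c *\<^sub>C y"
    and scaleC_add_left: "(c + d) *\<^sub>C x = c *\<^sub>C x + d *\<^sub>C x"
    and scaleC_scaleC: "c *\<^sub>C d *\<^sub>C x = (c * d) *\<^sub>C x"
    and scaleR_scaleC: "r *\<^sub>R x = complex_of_real r *\<^sub>C x"

text \<open>The complex inner product is conjugate-linear in its first argument; its real part is the
  inner product of the underlying real Hilbert space, so that norm, topology and completeness are
  those of the library.\<close>

class complex_inner = complex_vector + real_inner +
  fixes cinner :: "'a \<Rightarrow> 'a \<Rightarrow> complex"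
  assumes cinner_commute: "cinner x y = cnj (cinner y x)"
    and cinner_add_right: "cinner x (y + z) = cinner x y + cinner x z"
    and cinner_scaleC_right: "cinner x (c *\<^sub>C y) = c * cinner x y"
    and inner_eq_Re_cinner: "inner x y = Re (cinner x y)"

class chilbert_space = complex_inner + complete_space

instantiation complex :: chilbert_space
begin

definition scaleC_complex :: "complex \<Rightarrow> complex \<Rightarrow> complex"
  where "scaleC_complex c x = c * x"

definition cinner_complex :: "complex \<Rightarrow> complex \<Rightarrow> complex"
  where "cinner_complex x y = cnj x * y"

instance
  by standard
    (simp_all add: scaleC_complex_def cinner_complex_def algebra_simps inner_complex_def
      scaleR_conv_of_real)

end

lemma norm_scaleC: "norm (c *\<^sub>C x) = cmod c * norm (x :: 'a :: complex_inner)"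
proof -
  have real: "cinner x x = complex_of_real (inner x x)"
    by (metis cinner_commute inner_eq_Re_cinner complex_cnj_cancel_iff Reals_cnj_iff of_real_Re)
  have "cinner (c *\<^sub>C x) (c *\<^sub>C x) = c * cnj (cinner x (c *\<^sub>C x))"
    by (metis cinner_commute cinner_scaleC_right)
  also have "\<dots> = (c * cnj c) * complex_of_real (inner x x)"
    by (simp add: cinner_scaleC_right real mult.assoc)
  also have "\<dots> = complex_of_real ((cmod c)\<^sup>2 * inner x x)"
    by (simp only: of_real_mult complex_norm_square)
  finally have "inner (c *\<^sub>C x) (c *\<^sub>C x) = (cmod c)\<^sup>2 * inner x x"
    by (simp add: inner_eq_Re_cinner)
  then show ?thesis
    by (simp add: norm_eq_sqrt_inner real_sqrt_mult)
qed

lemma bounded_linear_scaleC: "bounded_linear (\<lambda>x :: 'a :: complex_inner. c *\<^sub>C x)"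
proof (rule bounded_linear_intro[where K = "cmod c"])
  show "c *\<^sub>C (r *\<^sub>R x) = r *\<^sub>R (c *\<^sub>C x)" for r and x :: 'a
    by (simp add: scaleR_scaleC scaleC_scaleC mult.commute)
qed (simp_all add: scaleC_add_right norm_scaleC mult.commute)

instantiation blinfun :: (real_normed_vector, complex_inner) complex_vector
begin

lift_definition scaleC_blinfun :: "complex \<Rightarrow> ('a \<Rightarrow>\<^sub>L 'b) \<Rightarrow> ('a \<Rightarrow>\<^sub>L 'b)"
  is "\<lambda>c f x. c *\<^sub>C f x"
  by (rule bounded_linear_compose[OF bounded_linear_scaleC])

instance
  by standard
    (transfer; simp add: fun_eq_iff scaleC_add_right scaleC_add_left scaleC_scaleC scaleR_scaleC)+

end

text \<open>The library's \<open>\<Rightarrow>\<^sub>L\<close> consists of the bounded real-linear maps; $B(H)$ is the subset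
  of the complex-linear ones.\<close>

definition bounded_operators :: "('h::chilbert_space \<Rightarrow>\<^sub>L 'h) set"
  where "bounded_operators = {a. \<forall>c x. blinfun_apply a (c *\<^sub>C x) = c *\<^sub>C blinfun_apply a x}"

definition adj :: "('h::chilbert_space \<Rightarrow>\<^sub>L 'h) \<Rightarrow> ('h \<Rightarrow>\<^sub>L 'h)"
  where "adj a = (THE b. \<forall>x y. cinner (blinfun_apply b x) y = cinner x (blinfun_apply a y))"

definition positive_op :: "('h::chilbert_space \<Rightarrow>\<^sub>L 'h) \<Rightarrow> bool"
  where "positive_op a \<longleftrightarrow> (\<forall>x. cinner x (blinfun_apply a x) \<in> \<real>\<^sub>\<ge>\<^sub>0)"

definition op_le :: "('h::chilbert_space \<Rightarrow>\<^sub>L 'h) \<Rightarrow> ('h \<Rightarrow>\<^sub>L 'h) \<Rightarrow> bool"  (infix "\<preceq>" 50)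
  where "a \<preceq> b \<longleftrightarrow> positive_op (b - a)"

definition self_adjoint_part :: "('h::chilbert_space \<Rightarrow>\<^sub>L 'h) set \<Rightarrow> ('h \<Rightarrow>\<^sub>L 'h) set"
  where "self_adjoint_part M = {a \<in> M. adj a = a}"


section \<open>Von Neumann algebras and conditional expectations\<close>

definition commutant :: "('h::chilbert_space \<Rightarrow>\<^sub>L 'h) set \<Rightarrow> ('h \<Rightarrow>\<^sub>L 'h) set"
  where "commutant S = {a \<in> bounded_operators. \<forall>s\<in>S. a o\<^sub>L s = s o\<^sub>L a}"

definition von_neumann_algebra :: "('h::chilbert_space \<Rightarrow>\<^sub>L 'h) set \<Rightarrow> bool"
  where "von_neumann_algebra M \<longleftrightarrow>
    M \<subseteq> bounded_operators \<and> (\<forall>a\<in>M. adj a \<in> M) \<and> commutant (commutant M) = M"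

definition conditional_expectation ::
    "('h::chilbert_space \<Rightarrow>\<^sub>L 'h) set \<Rightarrow> ('h \<Rightarrow>\<^sub>L 'h) set \<Rightarrow> (('h \<Rightarrow>\<^sub>L 'h) \<Rightarrow> ('h \<Rightarrow>\<^sub>L 'h)) \<Rightarrow> bool"
  where "conditional_expectation M D E \<longleftrightarrow>
    (\<forall>x\<in>M. E x \<in> D) \<and>
    (\<forall>x\<in>M. \<forall>y\<in>M. E (x + y) = E x + E y) \<and>
    (\<forall>c. \<forall>x\<in>M. E (c *\<^sub>C x) = c *\<^sub>C E x) \<and>
    (\<forall>x\<in>M. positive_op x \<longrightarrow> positive_op (E x)) \<and>
    (\<forall>d\<in>D. E d = d) \<and>
    (\<forall>d\<in>D. \<forall>d'\<in>D. \<forall>x\<in>M. E (d o\<^sub>L x o\<^sub>L d') = d o\<^sub>L E x o\<^sub>L d')"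

definition faithful_map ::
    "('h::chilbert_space \<Rightarrow>\<^sub>L 'h) set \<Rightarrow> (('h \<Rightarrow>\<^sub>L 'h) \<Rightarrow> ('h \<Rightarrow>\<^sub>L 'h)) \<Rightarrow> bool"
  where "faithful_map M E \<longleftrightarrow> (\<forall>x\<in>M. E (adj x o\<^sub>L x) = 0 \<longrightarrow> x = 0)"

definition is_op_sup ::
    "('h::chilbert_space \<Rightarrow>\<^sub>L 'h) set \<Rightarrow> ('h \<Rightarrow>\<^sub>L 'h) set \<Rightarrow> ('h \<Rightarrow>\<^sub>L 'h) \<Rightarrow> bool"
  where "is_op_sup M S x \<longleftrightarrow>
    x \<in> self_adjoint_part M \<and> (\<forall>s\<in>S. s \<preceq> x) \<and>
    (\<forall>y\<in>self_adjoint_part M. (\<forall>s\<in>S. s \<preceq> y) \<longrightarrow> x \<preceq> y)"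

text \<open>Normality: suprema of bounded increasing nets of self-adjoint elements are preserved. Nets
  are replaced by upward directed sets.\<close>

definition normal_map ::
    "('h::chilbert_space \<Rightarrow>\<^sub>L 'h) set \<Rightarrow> ('h \<Rightarrow>\<^sub>L 'h) set \<Rightarrow> (('h \<Rightarrow>\<^sub>L 'h) \<Rightarrow> ('h \<Rightarrow>\<^sub>L 'h)) \<Rightarrow> bool"
  where "normal_map M D E \<longleftrightarrow>
    (\<forall>S x. S \<noteq> {} \<and> S \<subseteq> self_adjoint_part M \<and>
       (\<forall>a\<in>S. \<forall>b\<in>S. \<exists>c\<in>S. a \<preceq> c \<and> b \<preceq> c) \<and> is_op_sup M S x
       \<longrightarrow> is_op_sup D (E ` S) (E x))"


section \<open>The Hilbert module $L^2_D(M)$\<close>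

text \<open>Throughout, \<open>E\<close> is the conditional expectation of \<open>M\<close> onto \<open>D\<close>.\<close>

definition module_inner ::
    "(('h::chilbert_space \<Rightarrow>\<^sub>L 'h) \<Rightarrow> ('h \<Rightarrow>\<^sub>L 'h)) \<Rightarrow> ('h \<Rightarrow>\<^sub>L 'h) \<Rightarrow> ('h \<Rightarrow>\<^sub>L 'h) \<Rightarrow> ('h \<Rightarrow>\<^sub>L 'h)"
  where "module_inner E x y = E (adj x o\<^sub>L y)"

definition module_norm :: "(('h::chilbert_space \<Rightarrow>\<^sub>L 'h) \<Rightarrow> ('h \<Rightarrow>\<^sub>L 'h)) \<Rightarrow> ('h \<Rightarrow>\<^sub>L 'h) \<Rightarrow> real"
  where "module_norm E x = sqrt (norm (module_inner E x x))"

definition l2_cauchy ::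
    "(('h::chilbert_space \<Rightarrow>\<^sub>L 'h) \<Rightarrow> ('h \<Rightarrow>\<^sub>L 'h)) \<Rightarrow> ('h \<Rightarrow>\<^sub>L 'h) set \<Rightarrow> (nat \<Rightarrow> 'h \<Rightarrow>\<^sub>L 'h) set"
  where "l2_cauchy E M =
    {x. (\<forall>n. x n \<in> M) \<and> (\<forall>e>0. \<exists>N. \<forall>m\<ge>N. \<forall>n\<ge>N. module_norm E (x m - x n) < e)}"

definition l2_rel ::
    "(('h::chilbert_space \<Rightarrow>\<^sub>L 'h) \<Rightarrow> ('h \<Rightarrow>\<^sub>L 'h)) \<Rightarrow> ('h \<Rightarrow>\<^sub>L 'h) set
     \<Rightarrow> ((nat \<Rightarrow> 'h \<Rightarrow>\<^sub>L 'h) \<times> (nat \<Rightarrow> 'h \<Rightarrow>\<^sub>L 'h)) set"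
  where "l2_rel E M =
    {(x, y). x \<in> l2_cauchy E M \<and> y \<in> l2_cauchy E M \<and>
             (\<lambda>n. module_norm E (x n - y n)) \<longlonglongrightarrow> 0}"

text \<open>The completion of \<open>M\<close>: Cauchy sequences modulo null sequences. Of the module structure,
  only differences and the \<open>D\<close>-valued inner product are needed; both are computed on
  representatives.\<close>

definition L2 ::
    "(('h::chilbert_space \<Rightarrow>\<^sub>L 'h) \<Rightarrow> ('h \<Rightarrow>\<^sub>L 'h)) \<Rightarrow> ('h \<Rightarrow>\<^sub>L 'h) set
     \<Rightarrow> (nat \<Rightarrow> 'h \<Rightarrow>\<^sub>L 'h) set set"
  where "L2 E M = l2_cauchy E M // l2_rel E M"

definition l2_embed ::
    "(('h::chilbert_space \<Rightarrow>\<^sub>L 'h) \<Rightarrow> ('h \<Rightarrow>\<^sub>L 'h)) \<Rightarrow> ('h \<Rightarrow>\<^sub>L 'h) set \<Rightarrow> ('h \<Rightarrow>\<^sub>L 'h)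
     \<Rightarrow> (nat \<Rightarrow> 'h \<Rightarrow>\<^sub>L 'h) set"
  where "l2_embed E M a = l2_rel E M `` {\<lambda>n. a}"

definition l2_rep :: "(nat \<Rightarrow> 'h::chilbert_space \<Rightarrow>\<^sub>L 'h) set \<Rightarrow> nat \<Rightarrow> 'h \<Rightarrow>\<^sub>L 'h"
  where "l2_rep \<xi> = (SOME x. x \<in> \<xi>)"

definition l2_minus ::
    "(('h::chilbert_space \<Rightarrow>\<^sub>L 'h) \<Rightarrow> ('h \<Rightarrow>\<^sub>L 'h)) \<Rightarrow> ('h \<Rightarrow>\<^sub>L 'h) set
     \<Rightarrow> (nat \<Rightarrow> 'h \<Rightarrow>\<^sub>L 'h) set \<Rightarrow> (nat \<Rightarrow> 'h \<Rightarrow>\<^sub>L 'h) set \<Rightarrow> (nat \<Rightarrow> 'h \<Rightarrow>\<^sub>L 'h) set"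
  where "l2_minus E M \<xi> \<eta> = l2_rel E M `` {\<lambda>n. l2_rep \<xi> n - l2_rep \<eta> n}"

definition l2_inner ::
    "(('h::chilbert_space \<Rightarrow>\<^sub>L 'h) \<Rightarrow> ('h \<Rightarrow>\<^sub>L 'h))
     \<Rightarrow> (nat \<Rightarrow> 'h \<Rightarrow>\<^sub>L 'h) set \<Rightarrow> (nat \<Rightarrow> 'h \<Rightarrow>\<^sub>L 'h) set \<Rightarrow> ('h \<Rightarrow>\<^sub>L 'h)"
  where "l2_inner E \<xi> \<eta> = lim (\<lambda>n. module_inner E (l2_rep \<xi> n) (l2_rep \<eta> n))"

definition l2_norm ::
    "(('h::chilbert_space \<Rightarrow>\<^sub>L 'h) \<Rightarrow> ('h \<Rightarrow>\<^sub>L 'h)) \<Rightarrow> (nat \<Rightarrow> 'h \<Rightarrow>\<^sub>L 'h) set \<Rightarrow> real"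
  where "l2_norm E \<xi> = sqrt (norm (l2_inner E \<xi> \<xi>))"

definition l2_closure ::
    "(('h::chilbert_space \<Rightarrow>\<^sub>L 'h) \<Rightarrow> ('h \<Rightarrow>\<^sub>L 'h)) \<Rightarrow> ('h \<Rightarrow>\<^sub>L 'h) set \<Rightarrow> ('h \<Rightarrow>\<^sub>L 'h) set
     \<Rightarrow> (nat \<Rightarrow> 'h \<Rightarrow>\<^sub>L 'h) set set"
  where "l2_closure E M A =
    {\<xi> \<in> L2 E M. \<forall>e>0. \<exists>p\<in>A. l2_norm E (l2_minus E M \<xi> (l2_embed E M p)) < e}"


section \<open>Noncommutative polynomials in $X$ with coefficients in $B$\<close>

definition unital_star_algebra :: "('h::chilbert_space \<Rightarrow>\<^sub>L 'h) set \<Rightarrow> bool"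
  where "unital_star_algebra A \<longleftrightarrow>
    id_blinfun \<in> A \<and>
    (\<forall>a\<in>A. \<forall>b\<in>A. a + b \<in> A) \<and>
    (\<forall>a\<in>A. \<forall>b\<in>A. a o\<^sub>L b \<in> A) \<and>
    (\<forall>c. \<forall>a\<in>A. c *\<^sub>C a \<in> A) \<and>
    (\<forall>a\<in>A. adj a \<in> A)"

definition adjoin :: "('h::chilbert_space \<Rightarrow>\<^sub>L 'h) set \<Rightarrow> ('h \<Rightarrow>\<^sub>L 'h) \<Rightarrow> ('h \<Rightarrow>\<^sub>L 'h) set"
  where "adjoin B X = unital_star_algebra hull (insert X B)"

definition additive_subgroup :: "'a::ab_group_add set \<Rightarrow> bool"
  where "additive_subgroup S \<longleftrightarrow> 0 \<in> S \<and> (\<forall>x\<in>S. \<forall>y\<in>S. x - y \<in> S)"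

text \<open>The algebra of formal polynomials is $\bigoplus_n B^{\otimes (n+1)}$ (tensor products over
  the complex numbers), the list $[b_0, \dots, b_n]$ standing for the monomial
  $b_0 t b_1 \cdots t b_n$. As usual for tensor products, it is presented as a quotient of the free
  abelian group on these lists, \<open>poly_null\<close> being the subgroup of relations (additivity in each
  coefficient, and moving complex scalars across the indeterminate $t$); scalars act on a
  coefficient, so integer combinations of monomials suffice.\<close>

definition formal_polys :: "('h::chilbert_space \<Rightarrow>\<^sub>L 'h) set \<Rightarrow> (('h \<Rightarrow>\<^sub>L 'h) list \<Rightarrow>\<^sub>0 int) set"
  where "formal_polys B = {f. Poly_Mapping.keys f \<subseteq> lists B - {[]}}"

definition poly_null :: "('h::chilbert_space \<Rightarrow>\<^sub>L 'h) set \<Rightarrow> (('h \<Rightarrow>\<^sub>L 'h) list \<Rightarrow>\<^sub>0 int) set"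
  where "poly_null B = additive_subgroup hull
    ({frag_of (u @ [x + y] @ v) - frag_of (u @ [x] @ v) - frag_of (u @ [y] @ v) | u v x y.
        u \<in> lists B \<and> v \<in> lists B \<and> x \<in> B \<and> y \<in> B} \<union>
     {frag_of (u @ [c *\<^sub>C x, y] @ v) - frag_of (u @ [x, c *\<^sub>C y] @ v) | u v c x y.
        u \<in> lists B \<and> v \<in> lists B \<and> x \<in> B \<and> y \<in> B})"

fun monomial_eval ::
    "('h::chilbert_space \<Rightarrow>\<^sub>L 'h) \<Rightarrow> ('h \<Rightarrow>\<^sub>L 'h) list \<Rightarrow> ('h \<Rightarrow>\<^sub>L 'h)"
  where
    "monomial_eval X [] = id_blinfun"
  | "monomial_eval X [b] = b"
  | "monomial_eval X (b # c # bs) = b o\<^sub>L X o\<^sub>L monomial_eval X (c # bs)"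

definition poly_eval ::
    "('h::chilbert_space \<Rightarrow>\<^sub>L 'h) \<Rightarrow> (('h \<Rightarrow>\<^sub>L 'h) list \<Rightarrow>\<^sub>0 int) \<Rightarrow> ('h \<Rightarrow>\<^sub>L 'h)"
  where "poly_eval X f =
    (\<Sum>w\<in>Poly_Mapping.keys f. real_of_int (Poly_Mapping.lookup f w) *\<^sub>R monomial_eval X w)"

text \<open>Injectivity of the homomorphism induced by \<open>poly_eval X\<close> on the quotient by
  \<open>poly_null B\<close>.\<close>

definition algebraically_free ::
    "('h::chilbert_space \<Rightarrow>\<^sub>L 'h) set \<Rightarrow> ('h \<Rightarrow>\<^sub>L 'h) \<Rightarrow> bool"
  where "algebraically_free B X \<longleftrightarrow>
    (\<forall>f\<in>formal_polys B. poly_eval X f = 0 \<longrightarrow> f \<in> poly_null B)"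


section \<open>Free difference quotient and conjugate variable\<close>

text \<open>For an algebra \<open>A\<close> containing \<open>D\<close>, the tensor product of \<open>A\<close> with itself over \<open>D\<close> is the
  free abelian group on \<open>A \<times> A\<close> modulo \<open>tensor_null D A\<close>; its elements are cosets.\<close>

definition tensor_null ::
    "('h::chilbert_space \<Rightarrow>\<^sub>L 'h) set \<Rightarrow> ('h \<Rightarrow>\<^sub>L 'h) set
     \<Rightarrow> (('h \<Rightarrow>\<^sub>L 'h) \<times> ('h \<Rightarrow>\<^sub>L 'h) \<Rightarrow>\<^sub>0 int) set"
  where "tensor_null D A = additive_subgroup hull
    ({frag_of (x + y, z) - frag_of (x, z) - frag_of (y, z) | x y z. x \<in> A \<and> y \<in> A \<and> z \<in> A} \<union>
     {frag_of (x, y + z) - frag_of (x, y) - frag_of (x, z) | x y z. x \<in> A \<and> y \<in> A \<and> z \<in> A} \<union>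
     {frag_of (x o\<^sub>L d, y) - frag_of (x, d o\<^sub>L y) | x y d. x \<in> A \<and> y \<in> A \<and> d \<in> D})"

definition tensor_class ::
    "('h::chilbert_space \<Rightarrow>\<^sub>L 'h) set \<Rightarrow> ('h \<Rightarrow>\<^sub>L 'h) set
     \<Rightarrow> (('h \<Rightarrow>\<^sub>L 'h) \<times> ('h \<Rightarrow>\<^sub>L 'h) \<Rightarrow>\<^sub>0 int) \<Rightarrow> (('h \<Rightarrow>\<^sub>L 'h) \<times> ('h \<Rightarrow>\<^sub>L 'h) \<Rightarrow>\<^sub>0 int) set"
  where "tensor_class D A s = {t. t - s \<in> tensor_null D A}"

definition tensor_inner ::
    "(('h::chilbert_space \<Rightarrow>\<^sub>L 'h) \<Rightarrow> ('h \<Rightarrow>\<^sub>L 'h))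
     \<Rightarrow> (('h \<Rightarrow>\<^sub>L 'h) \<times> ('h \<Rightarrow>\<^sub>L 'h) \<Rightarrow>\<^sub>0 int) set \<Rightarrow> (('h \<Rightarrow>\<^sub>L 'h) \<times> ('h \<Rightarrow>\<^sub>L 'h) \<Rightarrow>\<^sub>0 int) set
     \<Rightarrow> ('h \<Rightarrow>\<^sub>L 'h)"
  where "tensor_inner E S T =
    (let s = SOME s. s \<in> S; t = SOME t. t \<in> T in
      \<Sum>(p1, q1)\<in>Poly_Mapping.keys s. \<Sum>(p2, q2)\<in>Poly_Mapping.keys t.
        real_of_int (Poly_Mapping.lookup s (p1, q1) * Poly_Mapping.lookup t (p2, q2)) *\<^sub>R
          E (adj q1 o\<^sub>L E (adj p1 o\<^sub>L p2) o\<^sub>L q2))"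

definition monomial_diff ::
    "('h::chilbert_space \<Rightarrow>\<^sub>L 'h) \<Rightarrow> ('h \<Rightarrow>\<^sub>L 'h) list \<Rightarrow> (('h \<Rightarrow>\<^sub>L 'h) \<times> ('h \<Rightarrow>\<^sub>L 'h) \<Rightarrow>\<^sub>0 int)"
  where "monomial_diff X w =
    (\<Sum>j = 1..<length w. frag_of (monomial_eval X (take j w), monomial_eval X (drop j w)))"

text \<open>The derivation is computed on any formal polynomial \<open>f\<close> representing \<open>p\<close>; if \<open>X\<close> is
  algebraically free, the resulting class does not depend on \<open>f\<close>.\<close>

definition free_diff_quotient ::
    "('h::chilbert_space \<Rightarrow>\<^sub>L 'h) set \<Rightarrow> ('h \<Rightarrow>\<^sub>L 'h) set \<Rightarrow> ('h \<Rightarrow>\<^sub>L 'h) \<Rightarrow> ('h \<Rightarrow>\<^sub>L 'h)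
     \<Rightarrow> (('h \<Rightarrow>\<^sub>L 'h) \<times> ('h \<Rightarrow>\<^sub>L 'h) \<Rightarrow>\<^sub>0 int) set"
  where "free_diff_quotient D B X p =
    tensor_class D (adjoin B X)
      (frag_extend (monomial_diff X) (SOME f. f \<in> formal_polys B \<and> poly_eval X f = p))"

definition is_conjugate_variable ::
    "(('h::chilbert_space \<Rightarrow>\<^sub>L 'h) \<Rightarrow> ('h \<Rightarrow>\<^sub>L 'h)) \<Rightarrow> ('h \<Rightarrow>\<^sub>L 'h) set \<Rightarrow> ('h \<Rightarrow>\<^sub>L 'h) set
     \<Rightarrow> ('h \<Rightarrow>\<^sub>L 'h) set \<Rightarrow> ('h \<Rightarrow>\<^sub>L 'h) \<Rightarrow> (nat \<Rightarrow> 'h \<Rightarrow>\<^sub>L 'h) set \<Rightarrow> bool"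
  where "is_conjugate_variable E M D B X J \<longleftrightarrow>
    J \<in> l2_closure E M (adjoin B X) \<and>
    (\<forall>p\<in>adjoin B X.
       l2_inner E J (l2_embed E M p) =
       tensor_inner E (tensor_class D (adjoin B X) (frag_of (id_blinfun, id_blinfun)))
         (free_diff_quotient D B X p))"

text \<open>A conjugate variable is unique, being determined by its inner products with a dense
  subspace of the closure in which it lies.\<close>

definition conjugate_variable ::
    "(('h::chilbert_space \<Rightarrow>\<^sub>L 'h) \<Rightarrow> ('h \<Rightarrow>\<^sub>L 'h)) \<Rightarrow> ('h \<Rightarrow>\<^sub>L 'h) set \<Rightarrow> ('h \<Rightarrow>\<^sub>L 'h) set
     \<Rightarrow> ('h \<Rightarrow>\<^sub>L 'h) set \<Rightarrow> ('h \<Rightarrow>\<^sub>L 'h) \<Rightarrow> (nat \<Rightarrow> 'h \<Rightarrow>\<^sub>L 'h) set"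
  where "conjugate_variable E M D B X = (SOME J. is_conjugate_variable E M D B X J)"

definition free_fisher_information ::
    "(('h::chilbert_space \<Rightarrow>\<^sub>L 'h) \<Rightarrow> ('h \<Rightarrow>\<^sub>L 'h)) \<Rightarrow> ('h \<Rightarrow>\<^sub>L 'h) set \<Rightarrow> ('h \<Rightarrow>\<^sub>L 'h) set
     \<Rightarrow> ('h \<Rightarrow>\<^sub>L 'h) set \<Rightarrow> ('h \<Rightarrow>\<^sub>L 'h) \<Rightarrow> ('h \<Rightarrow>\<^sub>L 'h)"
  where "free_fisher_information E M D B X =
    l2_inner E (conjugate_variable E M D B X) (conjugate_variable E M D B X)"

definition MSE ::
    "(('h::chilbert_space \<Rightarrow>\<^sub>L 'h) \<Rightarrow> ('h \<Rightarrow>\<^sub>L 'h)) \<Rightarrow> ('h \<Rightarrow>\<^sub>L 'h) \<Rightarrow> ('h \<Rightarrow>\<^sub>L 'h) \<Rightarrow> real"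
  where "MSE E R A = norm (E ((R - A) o\<^sub>L (R - A)))"

end

theory Submission
  imports Defs
begin

text \<open>Since \<open>\<partial>X = 1 \<otimes> 1\<close>, the conjugate variable \<open>J\<close> satisfies
  \<open>\<langle>J, X\<rangle> = \<langle>1 \<otimes> 1, 1 \<otimes> 1\<rangle> = 1\<close>, and the Cauchy-Schwarz inequality in the Hilbert module gives
  \<open>1 \<le> \<parallel>\<langle>J, J\<rangle>\<parallel> \<parallel>E (X\<^sup>2)\<parallel> \<le> K \<parallel>E (X\<^sup>2)\<parallel>\<close>. For self-adjoint \<open>A\<close> in \<open>D\<close>, expanding the square
  around the conditional mean gives \<open>E ((R - A)\<^sup>2) = E (X\<^sup>2) + (E R - A)\<^sup>2\<close>, so that \<open>A = E R\<close> is
  optimal.\<close>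

section \<open>Adjoints and positive operators\<close>

text \<open>The obstacle lies in the choices built into the objects: the free difference quotient is
  computed on some formal polynomial with value \<open>X\<close>, the tensor pairing on some members
  of two cosets, and the inner product of the completion on some representing sequences. The class
  \<partial>X is therefore not identified itself; only its pairing with 1 \<otimes> 1 is evaluated.
  This pairing is an additive map from formal polynomials to operators that vanishes on their
  relations, and by freeness every polynomial with value \<open>X\<close> differs from the monomial
  1 t 1 by relations, so that the choice does not matter. The operator theory runs on the real inner
  product: for complex-linear operators the complex adjoint identity reduces to the real one, and
  Riesz representation of real functionals yields adjoints. The hypothesis on the Fisher information
  is an order bound; it turns into a norm bound because the norm of a positive operator is
  controlled by its quadratic form.\<close>

instance chilbert_space \<subseteq> banach ..

section \<open>Riesz representation of real functionals\<close>

lemma nonneg_parabola_imp_zero: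
  fixes b c :: real
  assumes "\<And>t. 0 \<le> t * b + t\<^sup>2 * c"
  shows "b = 0"
proof (rule ccontr)
  assume "b \<noteq> 0"
  \<comment> \<open>At \<open>t = - b / s\<close> the value is
    \<open>b\<^sup>2 * (c - s) / s\<^sup>2\<close>, which is negative as soon as \<open>s\<close> is
    positive and exceeds \<open>c\<close>.\<close>
  define s where "s = \<bar>c\<bar> + 1"
  have "s > 0" "c - s < 0"
    unfolding s_def by auto
  have "0 \<le> (- b / s) * b + (- b / s)\<^sup>2 * c"
    by (rule assms)
  also have "\<dots> = b\<^sup>2 * (c - s) / s\<^sup>2"
    using \<open>s > 0\<close> by (simp add: field_simps power2_eq_square)
  also have "\<dots> < 0"
    using \<open>b \<noteq> 0\<close> \<open>s > 0\<close> \<open>c - s < 0\<close> by (simp add: divide_neg_pos mult_pos_neg)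
  finally show False by simp
qed

text \<open>The representing vector minimises \<open>\<parallel>x\<parallel>\<^sup>2 - 2 f x\<close>; minimising sequences are Cauchy by the
  parallelogram law.\<close>

lemma riesz_representation:
  fixes f :: "'a::{real_inner, complete_space} \<Rightarrow> real"
  assumes "bounded_linear f"
  obtains z where "\<And>x. f x = inner z x"
proof -
  interpret f: bounded_linear f by fact
  define q where "q x = inner x x - 2 * f x" for x
  obtain L where L: "\<And>x. norm (f x) \<le> norm x * L"
    using f.bounded by blast
  \<comment> \<open>Completing the square in \<open>(norm x)\<^sup>2 - 2 * (norm x * L)\<close>, so
    that the infimum of \<open>q\<close> is finite.\<close>
  have q_ge: "- L\<^sup>2 \<le> q x" for x
  proof -
    have "0 \<le> (norm x - L)\<^sup>2" by simp
    then have "2 * (norm x * L) \<le> (norm x)\<^sup>2 + L\<^sup>2"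
      by (simp add: power2_diff)
    moreover have "f x \<le> norm x * L"
      using L[of x] by simp
    ultimately show ?thesis
      by (simp add: q_def power2_norm_eq_inner)
  qed
  define m where "m = Inf (range q)"
  have bdd: "bdd_below (range q)"
    using q_ge by (auto simp: bdd_below_def)
  have m_le: "m \<le> q x" for x
    unfolding m_def by (rule cInf_lower) (use bdd in auto)
  have "\<exists>x. q x < m + inverse (real (Suc n))" for n
  proof -
    have "Inf (range q) < m + inverse (real (Suc n))"
      by (simp add: m_def)
    then show ?thesis
      using cInf_lessD[of "range q"] by blast
  qed
  then obtain x where x: "\<And>n. q (x n) < m + inverse (real (Suc n))"
    by metis
  have gap: "(norm (u - v))\<^sup>2 \<le> 2 * (q u - m) + 2 * (q v - m)" for u v
  proof -
    have "q ((1/2) *\<^sub>R (u + v)) = (q u + q v) / 2 - (norm (u - v))\<^sup>2 / 4"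
      by (simp add: q_def f.scaleR f.add power2_norm_eq_inner inner_add inner_diff
          inner_commute[of v u] field_simps)
    with m_le[of "(1/2) *\<^sub>R (u + v)"]
    have "m \<le> (q u + q v) / 2 - (norm (u - v))\<^sup>2 / 4"
      by simp
    then show ?thesis
      by (simp add: field_simps)
  qed
  have "Cauchy x"
  proof (rule metric_CauchyI)
    fix e :: real assume "e > 0"
    then obtain N where N: "inverse (real (Suc N)) < e\<^sup>2 / 4"
      using reals_Archimedean[of "e\<^sup>2 / 4"] by auto
    have small: "q (x n) - m < e\<^sup>2 / 4" if "n \<ge> N" for n
    proof -
      have "inverse (real (Suc n)) \<le> inverse (real (Suc N))"
        using that by (intro le_imp_inverse_le) auto
      then show ?thesis using x[of n] N by linarith
    qed
    show "\<exists>N. \<forall>i\<ge>N. \<forall>j\<ge>N. dist (x i) (x j) < e"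
    proof (intro exI allI impI)
      fix i j assume "i \<ge> N" "j \<ge> N"
      have "2 * (q (x i) - m) + 2 * (q (x j) - m) < e\<^sup>2"
        using small[OF \<open>i \<ge> N\<close>] small[OF \<open>j \<ge> N\<close>] by (simp add: field_simps)
      with gap[of "x i" "x j"] have "(norm (x i - x j))\<^sup>2 < e\<^sup>2"
        by (rule order.strict_trans1)
      then show "dist (x i) (x j) < e"
        using \<open>e > 0\<close> by (simp add: dist_norm power2_less_imp_less)
    qed
  qed
  then obtain z where z: "x \<longlonglongrightarrow> z"
    using Cauchy_convergent convergent_def by blast
  have "(\<lambda>n. q (x n)) \<longlonglongrightarrow> q z"
    unfolding q_def by (intro tendsto_intros z f.tendsto)
  moreover have "(\<lambda>n. m + inverse (real (Suc n))) \<longlonglongrightarrow> m + 0"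
    by (intro tendsto_intros LIMSEQ_inverse_real_of_nat)
  ultimately have "q z \<le> m + 0"
    using x less_imp_le by (intro LIMSEQ_le[of "\<lambda>n. q (x n)"]) blast+
  then have min: "q z \<le> q y" for y
    using m_le[of y] by simp
  have "f y = inner z y" for y
  proof -
    \<comment> \<open>This is \<open>q (z + t *\<^sub>R y) - q z\<close> as a polynomial in
      \<open>t\<close>; its linear coefficient, the first variation at the minimiser, has to
      vanish.\<close>
    have "0 \<le> t * (2 * (inner z y - f y)) + t\<^sup>2 * inner y y" for t
      using min[of "z + t *\<^sub>R y"]
      by (simp add: q_def f.add f.scaleR inner_add inner_commute[of y z] power2_eq_square
          algebra_simps)
    from nonneg_parabola_imp_zero[OF this] show ?thesis by simp
  qed
  then show thesis by (rule that)
qed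

section \<open>Adjoints through the real inner product\<close>

lemma inner_scaleC_left: "inner (c *\<^sub>C x) y = inner x (cnj c *\<^sub>C (y::'a::complex_inner))"
proof -
  have "cinner (c *\<^sub>C x) y = cnj c * cinner x y"
    by (metis cinner_commute cinner_scaleC_right complex_cnj_mult)
  then show ?thesis
    by (simp add: inner_eq_Re_cinner cinner_scaleC_right)
qed

lemma scaleC_minus_left: "(- c) *\<^sub>C x = - (c *\<^sub>C (x::'a::complex_vector))"
  using scaleR_scaleC[of "-1" "c *\<^sub>C x"] by (simp add: scaleC_scaleC)

lemma scaleC_one [simp]: "1 *\<^sub>C (x::'a::complex_vector) = x"
  using scaleR_scaleC[of 1 x] by simp

text \<open>The imaginary part of a number is minus the real part of its multiple by
  \<open>\<i>\<close>. Complex identities thus reduce to identities for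
  \<open>inner\<close>.\<close>

lemma cinner_eq_inner:
  "cinner x y = Complex (inner x y) (- inner x (\<i> *\<^sub>C (y::'a::complex_inner)))"
  by (simp add: complex_eq_iff inner_eq_Re_cinner cinner_scaleC_right)

lemma bounded_operators_scaleC:
  "a \<in> bounded_operators \<Longrightarrow> blinfun_apply a (c *\<^sub>C x) = c *\<^sub>C blinfun_apply a x"
  by (simp add: bounded_operators_def)

lemma blinfun_eq_if_inner_eq:
  fixes a b :: "'h::chilbert_space \<Rightarrow>\<^sub>L 'h"
  assumes "\<And>x y. inner (blinfun_apply a x) y = inner (blinfun_apply b x) y"
  shows "a = b"
  using assms by (intro blinfun_eqI) (meson vector_eq_rdot)

text \<open>Riesz representation gives a vector \<open>g x\<close> for each \<open>x\<close>;
  linearity of \<open>g\<close> follows from uniqueness, its bound from testing at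
  \<open>y = g x\<close>. So far \<open>a\<close> is only real-linear.\<close>

lemma ex_adj:
  fixes a :: "'h::chilbert_space \<Rightarrow>\<^sub>L 'h"
  shows "\<exists>b. \<forall>x y. inner (blinfun_apply b x) y = inner x (blinfun_apply a y)"
proof -
  have "\<exists>z. \<forall>y. inner x (blinfun_apply a y) = inner z y" for x
  proof -
    have "bounded_linear (\<lambda>y. inner x (blinfun_apply a y))"
      by (intro bounded_linear_intros)
    from riesz_representation[OF this] show ?thesis by blast
  qed
  then obtain g where g: "\<And>x y. inner x (blinfun_apply a y) = inner (g x) y"
    by metis
  have "bounded_linear g"
  proof (rule bounded_linear_intro[where K = "norm a"])
    show "g (x + y) = g x + g y" for x y
      by (rule vector_eq_rdot[THEN iffD1]) (simp add: g[symmetric] inner_add_left)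
    show "g (r *\<^sub>R x) = r *\<^sub>R g x" for r x
      by (rule vector_eq_rdot[THEN iffD1]) (simp add: g[symmetric])
    show "norm (g x) \<le> norm x * norm a" for x
    proof (cases "g x = 0")
      case False
      have "norm (g x) * norm (g x) = inner x (blinfun_apply a (g x))"
        by (simp add: g flip: power2_norm_eq_inner power2_eq_square)
      also have "\<dots> \<le> norm x * (norm a * norm (g x))"
        by (intro order_trans[OF norm_cauchy_schwarz] mult_left_mono norm_blinfun) simp
      finally show ?thesis using False by simp
    qed simp
  qed
  then show ?thesis
    by (intro exI[of _ "Blinfun g"]) (simp add: bounded_linear_Blinfun_apply g)
qed

text \<open>The complex identity at \<open>(x, y)\<close> consists of the real one at
  \<open>(x, y)\<close> and, by complex linearity of \<open>a\<close>, the real one at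
  \<open>(x, \<i> *\<^sub>C y)\<close>. Hence the definite description in \<open>adj\<close> picks
  out the real adjoint.\<close>

lemma inner_adj_cinner_adj:
  fixes a b :: "'h::chilbert_space \<Rightarrow>\<^sub>L 'h"
  assumes a: "a \<in> bounded_operators"
  shows "(\<forall>x y. cinner (blinfun_apply b x) y = cinner x (blinfun_apply a y)) \<longleftrightarrow>
    (\<forall>x y. inner (blinfun_apply b x) y = inner x (blinfun_apply a y))"
  by (simp add: cinner_eq_inner flip: bounded_operators_scaleC[OF a]) blast

lemma inner_adj:
  fixes a :: "'h::chilbert_space \<Rightarrow>\<^sub>L 'h"
  assumes a: "a \<in> bounded_operators"
  shows "inner (blinfun_apply (adj a) x) y = inner x (blinfun_apply a y)"
proof -
  have "\<exists>!b. \<forall>x y. inner (blinfun_apply b x) y = inner x (blinfun_apply a y)"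
    using ex_adj[of a] blinfun_eq_if_inner_eq by metis
  from theI'[OF this] show ?thesis
    unfolding adj_def inner_adj_cinner_adj[OF a] by blast
qed

lemma adj_eqI:
  fixes a :: "'h::chilbert_space \<Rightarrow>\<^sub>L 'h"
  assumes "a \<in> bounded_operators"
    and "\<And>x y. inner (blinfun_apply b x) y = inner x (blinfun_apply a y)"
  shows "adj a = b"
  by (rule blinfun_eq_if_inner_eq) (simp add: assms inner_adj)

lemma inner_adj_right:
  assumes "a \<in> bounded_operators"
  shows "inner x (blinfun_apply (adj a) y) = inner (blinfun_apply a x) y"
  by (metis assms inner_adj inner_commute)

lemma adj_in_bounded_operators:
  assumes a: "a \<in> bounded_operators"
  shows "adj a \<in> bounded_operators"
proof -
  have "blinfun_apply (adj a) (c *\<^sub>C x) = c *\<^sub>C blinfun_apply (adj a) x" for c x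
    by (rule vector_eq_rdot[THEN iffD1])
      (simp add: inner_adj a inner_scaleC_left bounded_operators_scaleC)
  then show ?thesis by (simp add: bounded_operators_def)
qed

lemma bounded_operators_add:
  "a \<in> bounded_operators \<Longrightarrow> b \<in> bounded_operators \<Longrightarrow> a + b \<in> bounded_operators"
  by (simp add: bounded_operators_def blinfun.add_left scaleC_add_right)

lemma bounded_operators_compose:
  "a \<in> bounded_operators \<Longrightarrow> b \<in> bounded_operators \<Longrightarrow> a o\<^sub>L b \<in> bounded_operators"
  by (simp add: bounded_operators_def)

lemma bounded_operators_scaleC_op:
  "a \<in> bounded_operators \<Longrightarrow> c *\<^sub>C a \<in> bounded_operators"
  by (simp add: bounded_operators_def scaleC_blinfun.rep_eq scaleC_scaleC mult.commute)

lemma adj_adj: "a \<in> bounded_operators \<Longrightarrow> adj (adj a) = a"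
  by (rule adj_eqI) (simp_all add: adj_in_bounded_operators inner_adj_right)

lemma adj_id: "adj id_blinfun = id_blinfun"
  by (rule adj_eqI) (simp_all add: bounded_operators_def)

lemma adj_add:
  "a \<in> bounded_operators \<Longrightarrow> b \<in> bounded_operators \<Longrightarrow> adj (a + b) = adj a + adj b"
  by (rule adj_eqI)
    (simp_all add: bounded_operators_add blinfun.add_left inner_add inner_adj)

lemma adj_compose:
  "a \<in> bounded_operators \<Longrightarrow> b \<in> bounded_operators \<Longrightarrow> adj (a o\<^sub>L b) = adj b o\<^sub>L adj a"
  by (rule adj_eqI) (simp_all add: bounded_operators_compose inner_adj)

lemma adj_scaleC:
  "a \<in> bounded_operators \<Longrightarrow> adj (c *\<^sub>C a) = cnj c *\<^sub>C adj a"
  by (rule adj_eqI)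
    (simp_all add: bounded_operators_scaleC_op scaleC_blinfun.rep_eq inner_scaleC_left inner_adj
      bounded_operators_scaleC)

lemma compose_scaleC_left: "(c *\<^sub>C a) o\<^sub>L b = c *\<^sub>C (a o\<^sub>L b)"
  by (rule blinfun_eqI) (simp add: scaleC_blinfun.rep_eq)

lemma compose_scaleC_right:
  "a \<in> bounded_operators \<Longrightarrow> a o\<^sub>L (c *\<^sub>C b) = c *\<^sub>C (a o\<^sub>L b)"
  by (rule blinfun_eqI) (simp add: scaleC_blinfun.rep_eq bounded_operators_scaleC)

lemma compose_scaleR_left: "(r *\<^sub>R a) o\<^sub>L b = r *\<^sub>R (a o\<^sub>L b)"
  by (rule blinfun_eqI) (simp add: blinfun.scaleR_left)

lemma compose_scaleR_right: "a o\<^sub>L (r *\<^sub>R b) = r *\<^sub>R (a o\<^sub>L b)"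
  by (rule blinfun_eqI) (simp add: blinfun.scaleR_left blinfun.scaleR_right)

lemma compose_add_left: "(a + b) o\<^sub>L c = (a o\<^sub>L c) + (b o\<^sub>L c)"
  by (rule blinfun_eqI) (simp add: blinfun.add_left)

lemma compose_add_right: "a o\<^sub>L (b + c) = (a o\<^sub>L b) + (a o\<^sub>L c)"
  by (rule blinfun_eqI) (simp add: blinfun.add_left blinfun.add_right)

lemma compose_diff_left: "(a - b) o\<^sub>L c = (a o\<^sub>L c) - (b o\<^sub>L c)"
  by (rule blinfun_eqI) (simp add: blinfun.diff_left)

lemma compose_diff_right: "a o\<^sub>L (b - c) = (a o\<^sub>L b) - (a o\<^sub>L c)"
  by (rule blinfun_eqI) (simp add: blinfun.diff_left blinfun.diff_right)

lemma compose_assoc: "(a o\<^sub>L b) o\<^sub>L c = a o\<^sub>L (b o\<^sub>L c)"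
  by (rule blinfun_eqI) simp

lemma id_compose [simp]: "id_blinfun o\<^sub>L a = a" "a o\<^sub>L id_blinfun = a"
  by (rule blinfun_eqI; simp)+

section \<open>Positive operators\<close>

lemma positive_opD: "positive_op a \<Longrightarrow> 0 \<le> inner x (blinfun_apply a x)"
  by (simp add: positive_op_def cinner_eq_inner complex_nonneg_Reals_iff)

text \<open>\<open>positive_op\<close> asks for real values of the complex form. Self-adjointness
  provides this: \<open>inner x (\<i> *\<^sub>C blinfun_apply a x)\<close> equals its own
  negative.\<close>

lemma positive_opI:
  assumes "a \<in> bounded_operators" "adj a = a" "\<And>x. 0 \<le> inner x (blinfun_apply a x)"
  shows "positive_op a"
proof -
  have "inner x (\<i> *\<^sub>C blinfun_apply a x) = 0" for x
  proof -
    have "inner x (\<i> *\<^sub>C blinfun_apply a x) = inner (blinfun_apply a x) (\<i> *\<^sub>C x)"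
      by (metis assms(1,2) inner_adj bounded_operators_scaleC)
    also have "\<dots> = inner (\<i> *\<^sub>C x) (blinfun_apply a x)"
      by (rule inner_commute)
    also have "\<dots> = - inner x (\<i> *\<^sub>C blinfun_apply a x)"
      by (simp add: inner_scaleC_left scaleC_minus_left)
    finally show ?thesis by simp
  qed
  then show ?thesis
    by (simp add: positive_op_def cinner_eq_inner complex_nonneg_Reals_iff assms)
qed

lemma positive_op_adj_compose:
  assumes a: "a \<in> bounded_operators"
  shows "positive_op (adj a o\<^sub>L a)"
  by (rule positive_opI)
    (simp_all add: a bounded_operators_compose adj_in_bounded_operators adj_compose adj_adj
      inner_adj_right)

text \<open>Polarisation: the imaginary part of the quadratic form at \<open>x + \<i> y\<close> vanishes.\<close>

lemma positive_op_imp_adj_eq: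
  assumes a: "a \<in> bounded_operators" and pos: "positive_op a"
  shows "adj a = a"
proof (rule adj_eqI[OF a])
  have im: "inner x (\<i> *\<^sub>C blinfun_apply a x) = 0" for x
    using pos by (simp add: positive_op_def cinner_eq_inner complex_nonneg_Reals_iff)
  fix x y
  have ii: "\<i> *\<^sub>C \<i> *\<^sub>C z = - z" for z :: 'a
    using scaleR_scaleC[of "-1" z] by (simp add: scaleC_scaleC)
  have "inner x (\<i> *\<^sub>C blinfun_apply a (\<i> *\<^sub>C y)) = - inner x (blinfun_apply a y)"
    by (simp add: bounded_operators_scaleC[OF a] ii)
  moreover have "inner (\<i> *\<^sub>C y) (\<i> *\<^sub>C blinfun_apply a x) = inner y (blinfun_apply a x)"
    by (simp add: inner_scaleC_left scaleC_scaleC)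
  moreover have "inner x (\<i> *\<^sub>C blinfun_apply a (\<i> *\<^sub>C y))
      + inner (\<i> *\<^sub>C y) (\<i> *\<^sub>C blinfun_apply a x) = 0"
    using im[of "x + \<i> *\<^sub>C y"] im[of x] im[of "\<i> *\<^sub>C y"]
    by (simp add: blinfun.add_right scaleC_add_right inner_add)
  ultimately show "inner (blinfun_apply a x) y = inner x (blinfun_apply a y)"
    by (simp add: inner_commute)
qed

text \<open>For \<open>0 \<le> a \<le> c\<close> one has \<open>a (c - a) a + (c - a) a (c - a) = c (c a - a\<^sup>2)\<close>, so
  \<open>a\<^sup>2 \<le> c a\<close>.\<close>

lemma positive_op_norm_le:
  assumes a: "a \<in> bounded_operators" and pos: "positive_op a" and "0 \<le> c"
    and le: "\<And>x. inner x (blinfun_apply a x) \<le> c * (norm x)\<^sup>2"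
  shows "norm a \<le> c"
proof (rule field_le_epsilon)
  fix e :: real assume "e > 0"
  \<comment> \<open>The argument divides by the bound; \<open>e\<close> keeps it positive when
    \<open>c\<close> is 0.\<close>
  define k where "k = c + e"
  have "k > 0" using \<open>e > 0\<close> \<open>0 \<le> c\<close> by (simp add: k_def)
  have sym: "inner (blinfun_apply a x) y = inner x (blinfun_apply a y)" for x y
    using inner_adj[OF a, of x y] positive_op_imp_adj_eq[OF a pos] by simp
  have le': "inner x (blinfun_apply a x) \<le> k * (norm x)\<^sup>2" for x
    using le[of x] \<open>e > 0\<close> by (simp add: k_def distrib_right add_increasing2)
  have "norm a \<le> k"
  proof (rule norm_blinfun_bound)
    show "0 \<le> k" using \<open>k > 0\<close> by simp
    fix x
    let ?y = "blinfun_apply a x"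
    let ?u = "k *\<^sub>R x - ?y"
    \<comment> \<open>The forms of \<open>a (k - a) a\<close> and \<open>(k - a) a (k - a)\<close>
      at \<open>x\<close>, both nonnegative.\<close>
    have "0 \<le> k * (norm ?y)\<^sup>2 - inner ?y (blinfun_apply a ?y)"
      using le'[of ?y] by simp
    moreover have "0 \<le> inner ?u (blinfun_apply a ?u)"
      using positive_opD[OF pos] .
    moreover have "inner ?u (blinfun_apply a ?u) = k * (k * inner x ?y)
        - 2 * k * (norm ?y)\<^sup>2 + inner ?y (blinfun_apply a ?y)"
      by (simp add: blinfun.diff_right blinfun.scaleR_right inner_diff power2_norm_eq_inner
          sym[symmetric, of x ?y] algebra_simps)
    ultimately have "k * (norm ?y)\<^sup>2 \<le> k * (k * inner x ?y)" by simp
    also have "\<dots> \<le> k * (k * (k * (norm x)\<^sup>2))"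
      using le'[of x] \<open>k > 0\<close> by simp
    finally have "(norm ?y)\<^sup>2 \<le> (k * norm x)\<^sup>2"
      using \<open>k > 0\<close> by (simp add: power2_eq_square mult.assoc mult.left_commute)
    then show "norm ?y \<le> k * norm x"
      using \<open>k > 0\<close> power2_le_imp_le[of "norm ?y" "k * norm x"] by simp
  qed
  then show "norm a \<le> c + e" by (simp add: k_def)
qed

lemma inner_apply_le_norm: "inner x (blinfun_apply a x) \<le> norm a * (norm x)\<^sup>2"
proof -
  have "inner x (blinfun_apply a x) \<le> norm x * (norm a * norm x)"
    by (intro order_trans[OF norm_cauchy_schwarz] mult_left_mono norm_blinfun) simp
  then show ?thesis by (simp add: power2_eq_square mult_ac)
qed

section \<open>The Hilbert module of a conditional expectation\<close>

text \<open>\<open>M\<close> is the commutant of its own commutant, and every commutant of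
  complex-linear operators is a unital algebra; closure under \<open>adj\<close> is part of the
  definition.\<close>

lemma von_neumann_algebra_unital_star_algebra:
  assumes "von_neumann_algebra M"
  shows "unital_star_algebra M"
proof -
  define S where "S = commutant M"
  have S: "S \<subseteq> bounded_operators" and M: "M = commutant S"
    using assms by (auto simp: S_def commutant_def von_neumann_algebra_def)
  have "a \<in> M \<Longrightarrow> adj a \<in> M" for a
    using assms by (simp add: von_neumann_algebra_def)
  moreover have "a o\<^sub>L b \<in> M" if "a \<in> M" "b \<in> M" for a b
    using that unfolding M commutant_def
    by (simp add: bounded_operators_compose) (metis compose_assoc)
  moreover have "c *\<^sub>C a \<in> M" if "a \<in> M" for c a
    using that S unfolding M commutant_def
    by (auto simp: bounded_operators_scaleC_op compose_scaleC_left compose_scaleC_right subset_iff)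
  moreover have "a + b \<in> M" if "a \<in> M" "b \<in> M" for a b
    using that unfolding M commutant_def
    by (simp add: bounded_operators_add compose_add_left compose_add_right)
  moreover have "id_blinfun \<in> M"
    unfolding M commutant_def by (simp add: bounded_operators_def)
  ultimately show ?thesis
    by (simp add: unital_star_algebra_def)
qed

locale expectation =
  fixes M D :: "('h::chilbert_space \<Rightarrow>\<^sub>L 'h) set" and E :: "('h \<Rightarrow>\<^sub>L 'h) \<Rightarrow> ('h \<Rightarrow>\<^sub>L 'h)"
  assumes M: "von_neumann_algebra M" and D: "von_neumann_algebra D" and D_subset: "D \<subseteq> M"
    and E: "conditional_expectation M D E"
begin

lemma M_bounded [simp]: "x \<in> M \<Longrightarrow> x \<in> bounded_operators"
  using M by (auto simp: von_neumann_algebra_def)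

lemma M_closed [simp]:
  "id_blinfun \<in> M"
  "x \<in> M \<Longrightarrow> y \<in> M \<Longrightarrow> x + y \<in> M"
  "x \<in> M \<Longrightarrow> y \<in> M \<Longrightarrow> x o\<^sub>L y \<in> M"
  "x \<in> M \<Longrightarrow> c *\<^sub>C x \<in> M"
  "x \<in> M \<Longrightarrow> adj x \<in> M"
  using von_neumann_algebra_unital_star_algebra[OF M] by (auto simp: unital_star_algebra_def)

lemma M_scaleR [simp]: "x \<in> M \<Longrightarrow> r *\<^sub>R x \<in> M"
  by (simp add: scaleR_scaleC)

lemma M_uminus [simp]: "x \<in> M \<Longrightarrow> - x \<in> M"
  using M_scaleR[of x "-1"] by simp

lemma M_diff [simp]: "x \<in> M \<Longrightarrow> y \<in> M \<Longrightarrow> x - y \<in> M"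
  using M_closed(2)[of x "- y"] by simp

lemma D_closed [simp]:
  "id_blinfun \<in> D"
  "x \<in> D \<Longrightarrow> y \<in> D \<Longrightarrow> x + y \<in> D"
  "x \<in> D \<Longrightarrow> c *\<^sub>C x \<in> D"
  "x \<in> D \<Longrightarrow> adj x \<in> D"
  using von_neumann_algebra_unital_star_algebra[OF D] by (auto simp: unital_star_algebra_def)

lemma D_diff [simp]: "x \<in> D \<Longrightarrow> y \<in> D \<Longrightarrow> x - y \<in> D"
  using D_closed(2)[of x "- y"] D_closed(3)[of y "-1"] by (simp add: scaleC_minus_left)

lemma D_in_M [simp]: "x \<in> D \<Longrightarrow> x \<in> M"
  using D_subset by auto

lemma E_in_D [simp]: "x \<in> M \<Longrightarrow> E x \<in> D"
  and E_add: "x \<in> M \<Longrightarrow> y \<in> M \<Longrightarrow> E (x + y) = E x + E y"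
  and E_scaleC: "x \<in> M \<Longrightarrow> E (c *\<^sub>C x) = c *\<^sub>C E x"
  and E_positive: "x \<in> M \<Longrightarrow> positive_op x \<Longrightarrow> positive_op (E x)"
  and E_D: "d \<in> D \<Longrightarrow> E d = d"
  and E_bimodule: "d \<in> D \<Longrightarrow> d' \<in> D \<Longrightarrow> x \<in> M \<Longrightarrow> E (d o\<^sub>L x o\<^sub>L d') = d o\<^sub>L E x o\<^sub>L d'"
  using E unfolding conditional_expectation_def by blast+

lemma E_scaleR: "x \<in> M \<Longrightarrow> E (r *\<^sub>R x) = r *\<^sub>R E x"
  by (simp add: scaleR_scaleC E_scaleC)

lemma E_zero [simp]: "E 0 = 0"
  using E_scaleR[of id_blinfun 0] by simp

lemma E_diff: "x \<in> M \<Longrightarrow> y \<in> M \<Longrightarrow> E (x - y) = E x - E y"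
  using E_add[of x "(-1) *\<^sub>R y"] E_scaleR[of y "-1"] by simp

lemma E_compose_left: "d \<in> D \<Longrightarrow> x \<in> M \<Longrightarrow> E (d o\<^sub>L x) = d o\<^sub>L E x"
  using E_bimodule[of d id_blinfun x] by simp

lemma E_compose_right: "d \<in> D \<Longrightarrow> x \<in> M \<Longrightarrow> E (x o\<^sub>L d) = E x o\<^sub>L d"
  using E_bimodule[of id_blinfun d x] by simp

text \<open>A self-adjoint \<open>x\<close> is the difference of the positive operators \<open>x + \<parallel>x\<parallel>\<close> and \<open>\<parallel>x\<parallel>\<close>.\<close>

lemma adj_E_self_adjoint:
  assumes x: "x \<in> M" "adj x = x"
  shows "adj (E x) = E x"
proof -
  define s where "s = norm x *\<^sub>R (id_blinfun :: 'h \<Rightarrow>\<^sub>L 'h)"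
  have s: "s \<in> M" "adj s = s"
    by (simp_all add: s_def) (simp add: scaleR_scaleC adj_scaleC adj_id)
  have "positive_op s"
    using s by (intro positive_opI) (simp_all add: s_def blinfun.scaleR_left)
  moreover have "positive_op (x + s)"
  proof (rule positive_opI)
    fix v
    have "\<bar>inner v (blinfun_apply x v)\<bar> \<le> norm v * norm (blinfun_apply x v)"
      by (rule Cauchy_Schwarz_ineq2)
    also have "\<dots> \<le> norm v * (norm x * norm v)"
      by (intro mult_left_mono norm_blinfun) simp
    finally show "0 \<le> inner v (blinfun_apply (x + s) v)"
      by (simp add: s_def blinfun.add_left blinfun.scaleR_left inner_add_right
          flip: power2_norm_eq_inner) (simp add: power2_eq_square mult_ac)
  qed (use s x in \<open>simp_all add: adj_add\<close>)
  ultimately have "adj (E s) = E s" "adj (E (x + s)) = E (x + s)"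
    using s x by (simp_all add: positive_op_imp_adj_eq E_positive)
  then show ?thesis
    using s x by (simp add: E_add adj_add)
qed

text \<open>The definition of a conditional expectation asks for positivity but not for
  compatibility with adjoints. The latter passes from self-adjoint elements to all of
  \<open>M\<close> by splitting \<open>x\<close> into real and imaginary parts \<open>h\<close> and
  \<open>k\<close>.\<close>

lemma adj_E:
  assumes x: "x \<in> M"
  shows "adj (E x) = E (adj x)"
proof -
  define h where "h = (1/2) *\<^sub>C x + (1/2) *\<^sub>C adj x"
  define k where "k = (-\<i>/2) *\<^sub>C x + (\<i>/2) *\<^sub>C adj x"
  have h: "h \<in> M" "adj h = h" and k: "k \<in> M" "adj k = k"
    using x by (simp_all add: h_def k_def adj_add adj_scaleC adj_adj add.commute)
  have "(-1/2) *\<^sub>C adj x = - ((1/2) *\<^sub>C adj x)"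
    using scaleC_minus_left[of "1/2" "adj x"] by simp
  moreover have "(1/2) *\<^sub>C x + (1/2) *\<^sub>C x = x"
    by (simp flip: scaleC_add_left)
  ultimately have x_eq: "x = h + \<i> *\<^sub>C k"
    by (simp add: h_def k_def scaleC_add_right scaleC_scaleC)
  have "E (adj x) = E h + (- \<i>) *\<^sub>C E k"
    using h k by (simp add: x_eq adj_add adj_scaleC E_add E_scaleC)
  moreover have "adj (E x) = E h + (- \<i>) *\<^sub>C E k"
    using h k by (simp add: x_eq adj_add adj_scaleC E_add E_scaleC adj_E_self_adjoint)
  ultimately show ?thesis by simp
qed

section \<open>The \<open>D\<close>-valued inner product and its Cauchy-Schwarz inequality\<close>

abbreviation ip where "ip \<equiv> module_inner E"
abbreviation nrm where "nrm \<equiv> module_norm E"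

lemma adj_diff: "x \<in> M \<Longrightarrow> y \<in> M \<Longrightarrow> adj (x - y) = adj x - adj y"
  using adj_add[of x "- y"] adj_scaleC[of y "-1"] by (simp add: scaleC_minus_left)

lemma ip_in_D [simp]: "x \<in> M \<Longrightarrow> y \<in> M \<Longrightarrow> ip x y \<in> D"
  by (simp add: module_inner_def)

lemma ip_positive: "x \<in> M \<Longrightarrow> positive_op (ip x x)"
  by (simp add: module_inner_def E_positive positive_op_adj_compose)

lemma ip_diff_right: "x \<in> M \<Longrightarrow> y \<in> M \<Longrightarrow> z \<in> M \<Longrightarrow> ip x (y - z) = ip x y - ip x z"
  by (simp add: module_inner_def compose_diff_right E_diff)

lemma ip_diff_left: "x \<in> M \<Longrightarrow> y \<in> M \<Longrightarrow> z \<in> M \<Longrightarrow> ip (y - z) x = ip y x - ip z x"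
  by (simp add: module_inner_def adj_diff compose_diff_left E_diff)

lemma ip_scaleR_right: "x \<in> M \<Longrightarrow> y \<in> M \<Longrightarrow> ip x (r *\<^sub>R y) = r *\<^sub>R ip x y"
  by (simp add: module_inner_def compose_scaleR_right E_scaleR)

lemma ip_scaleR_left: "x \<in> M \<Longrightarrow> y \<in> M \<Longrightarrow> ip (r *\<^sub>R x) y = r *\<^sub>R ip x y"
  by (simp add: module_inner_def scaleR_scaleC adj_scaleC)
    (simp add: compose_scaleR_left E_scaleR flip: scaleR_scaleC)

lemma ip_compose_right: "x \<in> M \<Longrightarrow> y \<in> M \<Longrightarrow> d \<in> D \<Longrightarrow> ip x (y o\<^sub>L d) = ip x y o\<^sub>L d"
  by (simp add: module_inner_def E_compose_right flip: compose_assoc)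

lemma ip_compose_left: "x \<in> M \<Longrightarrow> y \<in> M \<Longrightarrow> d \<in> D \<Longrightarrow> ip (x o\<^sub>L d) y = adj d o\<^sub>L ip x y"
  by (simp add: module_inner_def adj_compose E_compose_left compose_assoc)

lemma adj_ip: "x \<in> M \<Longrightarrow> y \<in> M \<Longrightarrow> adj (ip x y) = ip y x"
  by (simp add: module_inner_def adj_E adj_compose adj_adj)

text \<open>Positivity of \<open>E (z\<^sup>* z)\<close> for \<open>z = x d - t y\<close> with \<open>d = E (x\<^sup>* y)\<close>.\<close>

lemma norm_ip_apply_le:
  assumes x: "x \<in> M" and y: "y \<in> M" and t: "norm (ip x x) \<le> t" "t > 0"
  shows "(norm (blinfun_apply (ip x y) v))\<^sup>2 \<le> t * inner v (blinfun_apply (ip y y) v)"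
proof -
  define d where "d = ip x y"
  have d: "d \<in> D" using x y by (simp add: d_def)
  define w where "w = blinfun_apply d v"
  define z where "z = (x o\<^sub>L d) - t *\<^sub>R y"
  have z: "z \<in> M" using x y d by (simp add: z_def)
  have yx: "ip y x = adj d" using x y by (simp add: d_def adj_ip)
  have "ip z z = (adj d o\<^sub>L ip x x o\<^sub>L d) - t *\<^sub>R (adj d o\<^sub>L d)
      - (t *\<^sub>R (adj d o\<^sub>L d) - (t * t) *\<^sub>R ip y y)"
    unfolding z_def using x y d
    by (simp add: ip_diff_left ip_diff_right ip_scaleR_left ip_scaleR_right ip_compose_left
        ip_compose_right yx d_def[symmetric] scaleR_diff_right compose_assoc
        compose_diff_left compose_scaleR_left)
  then have "inner v (blinfun_apply (ip z z) v)
      = inner w (blinfun_apply (ip x x) w) - 2 * t * (norm w)\<^sup>2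
        + t * t * inner v (blinfun_apply (ip y y) v)"
    using d by (simp add: blinfun.diff_left blinfun.scaleR_left inner_diff_right inner_adj_right
        w_def power2_norm_eq_inner)
  moreover have "0 \<le> inner v (blinfun_apply (ip z z) v)"
    by (intro positive_opD ip_positive z)
  \<comment> \<open>The choice of \<open>t\<close> enters here: the first term absorbs one of the
    two copies of \<open>t * (norm w)\<^sup>2\<close>.\<close>
  moreover have "inner w (blinfun_apply (ip x x) w) \<le> t * (norm w)\<^sup>2"
    using order_trans[OF inner_apply_le_norm mult_right_mono[OF t(1)]] by simp
  ultimately have "t * (norm w)\<^sup>2 \<le> t * (t * inner v (blinfun_apply (ip y y) v))"
    by simp
  then show ?thesis using t(2) by (simp add: w_def d_def)
qed

text \<open>The constant in \<open>norm_ip_apply_le\<close> must be positive while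
  \<open>ip x x\<close> may vanish; it is taken to be \<open>norm (ip x x) + e\<close>, and
  \<open>e\<close> tends to 0.\<close>

lemma cauchy_schwarz:
  assumes x: "x \<in> M" and y: "y \<in> M"
  shows "norm (ip x y) \<le> nrm x * nrm y"
proof (rule norm_blinfun_bound)
  fix v :: 'h
  define C where "C = norm (ip y y) * (norm v)\<^sup>2"
  have "(norm (blinfun_apply (ip x y) v))\<^sup>2 \<le> (norm (ip x x) + e) * C" if "e > 0" for e
  proof -
    have t: "norm (ip x x) + e > 0" using that by (simp add: add_nonneg_pos)
    have "(norm (blinfun_apply (ip x y) v))\<^sup>2
        \<le> (norm (ip x x) + e) * inner v (blinfun_apply (ip y y) v)"
      using that t by (intro norm_ip_apply_le x y) auto
    also have "\<dots> \<le> (norm (ip x x) + e) * C"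
      unfolding C_def using t by (intro mult_left_mono inner_apply_le_norm) auto
    finally show ?thesis .
  qed
  then have "\<forall>\<^sub>F e in at_right 0. (norm (blinfun_apply (ip x y) v))\<^sup>2 \<le> (norm (ip x x) + e) * C"
    by (auto simp: eventually_at_right_less intro: eventually_mono[OF eventually_at_right_less])
  moreover have "((\<lambda>e. (norm (ip x x) + e) * C) \<longlongrightarrow> (norm (ip x x) + 0) * C) (at_right 0)"
    by (intro tendsto_intros)
  ultimately have "(norm (blinfun_apply (ip x y) v))\<^sup>2 \<le> (norm (ip x x) + 0) * C"
    by (intro tendsto_lowerbound[where F = "at_right (0::real)"]) simp_all
  also have "\<dots> = (nrm x * nrm y * norm v)\<^sup>2"
    by (simp add: C_def module_norm_def power_mult_distrib)
  finally show "norm (blinfun_apply (ip x y) v) \<le> nrm x * nrm y * norm v"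
    by (rule power2_le_imp_le) (simp add: module_norm_def)
qed (simp add: module_norm_def)

lemma nrm_nonneg: "0 \<le> nrm x"
  by (simp add: module_norm_def)

lemma nrm_power2: "(nrm x)\<^sup>2 = norm (ip x x)"
  by (simp add: module_norm_def)

lemma nrm_diff_le:
  assumes x: "x \<in> M" and y: "y \<in> M"
  shows "nrm (x - y) \<le> nrm x + nrm y"
proof (rule power2_le_imp_le)
  have "ip (x - y) (x - y) = (ip x x - ip x y) - (ip y x - ip y y)"
    using x y by (simp add: ip_diff_left ip_diff_right)
  then have "norm (ip (x - y) (x - y)) \<le> norm (ip x x - ip x y) + norm (ip y x - ip y y)"
    by (simp only: norm_triangle_ineq4)
  also have "\<dots> \<le> (norm (ip x x) + norm (ip x y)) + (norm (ip y x) + norm (ip y y))"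
    by (intro add_mono norm_triangle_ineq4)
  also have "\<dots> \<le> ((nrm x)\<^sup>2 + nrm x * nrm y) + (nrm y * nrm x + (nrm y)\<^sup>2)"
    using x y by (intro add_mono cauchy_schwarz) (simp_all add: nrm_power2)
  also have "\<dots> = (nrm x + nrm y)\<^sup>2"
    by (simp add: power2_eq_square algebra_simps)
  finally show "(nrm (x - y))\<^sup>2 \<le> (nrm x + nrm y)\<^sup>2"
    by (simp add: nrm_power2)
qed (simp add: nrm_nonneg)

lemma nrm_triangle_diff:
  assumes "x \<in> M" "y \<in> M"
  shows "nrm x \<le> nrm y + nrm (x - y)"
proof -
  have "nrm (y - (y - x)) \<le> nrm y + nrm (y - x)"
    using assms by (intro nrm_diff_le) auto
  moreover have "nrm (y - x) = nrm (x - y)"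
    using assms by (simp add: module_norm_def ip_diff_left ip_diff_right algebra_simps)
  ultimately show ?thesis by simp
qed

section \<open>Inner products in the completion\<close>

lemma l2_cauchyD:
  assumes "x \<in> l2_cauchy E M"
  shows "x n \<in> M" and "e > 0 \<Longrightarrow> \<exists>N. \<forall>m\<ge>N. \<forall>n\<ge>N. nrm (x m - x n) < e"
  using assms by (simp_all add: l2_cauchy_def)

lemma l2_cauchy_bounded:
  assumes x: "x \<in> l2_cauchy E M"
  obtains C where "C > 0" "\<forall>\<^sub>F n in sequentially. nrm (x n) \<le> C"
proof -
  obtain N where N: "\<And>m n. m \<ge> N \<Longrightarrow> n \<ge> N \<Longrightarrow> nrm (x m - x n) < 1"
    using l2_cauchyD(2)[OF x, of 1] by auto
  have "nrm (x n) \<le> nrm (x N) + 1" if "n \<ge> N" for n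
    using nrm_triangle_diff[of "x n" "x N"] N[OF that, of N] l2_cauchyD(1)[OF x] by force
  then show thesis
    by (intro that[of "nrm (x N) + 1"]) (auto simp: eventually_sequentially nrm_nonneg add_nonneg_pos)
qed

text \<open>\<open>l2_inner\<close> is a \<open>lim\<close>, which is meaningful only for convergent
  sequences. The bounded operators are complete in norm, and Cauchy-Schwarz bounds the change in
  each argument separately.\<close>

lemma convergent_ip:
  assumes x: "x \<in> l2_cauchy E M" and y: "y \<in> l2_cauchy E M"
  shows "convergent (\<lambda>n. ip (x n) (y n))"
proof -
  note [simp] = l2_cauchyD(1)[OF x] l2_cauchyD(1)[OF y]
  obtain B where B: "B > 0" "\<forall>\<^sub>F n in sequentially. nrm (x n) \<le> B"
    by (rule l2_cauchy_bounded[OF x])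
  obtain C where C: "C > 0" "\<forall>\<^sub>F n in sequentially. nrm (y n) \<le> C"
    by (rule l2_cauchy_bounded[OF y])
  have "Cauchy (\<lambda>n. ip (x n) (y n))"
  proof (rule metric_CauchyI)
    fix e :: real assume "e > 0"
    then have e: "e / (2 * C) > 0" "e / (2 * B) > 0" using B C by simp_all
    obtain N where N: "\<And>n. n \<ge> N \<Longrightarrow> nrm (x n) \<le> B" "\<And>n. n \<ge> N \<Longrightarrow> nrm (y n) \<le> C"
      using eventually_conj[OF B(2) C(2)] by (auto simp: eventually_sequentially)
    obtain N1 where N1: "\<And>m n. m \<ge> N1 \<Longrightarrow> n \<ge> N1 \<Longrightarrow> nrm (x m - x n) < e / (2 * C)"
      using l2_cauchyD(2)[OF x e(1)] by auto
    obtain N2 where N2: "\<And>m n. m \<ge> N2 \<Longrightarrow> n \<ge> N2 \<Longrightarrow> nrm (y m - y n) < e / (2 * B)"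
      using l2_cauchyD(2)[OF y e(2)] by auto
    have "dist (ip (x m) (y m)) (ip (x n) (y n)) < e"
      if "m \<ge> N + N1 + N2" "n \<ge> N + N1 + N2" for m n
    proof -
      have "ip (x m) (y m) - ip (x n) (y n) = ip (x m - x n) (y m) + ip (x n) (y m - y n)"
        by (simp add: ip_diff_left ip_diff_right)
      then have "dist (ip (x m) (y m)) (ip (x n) (y n))
          \<le> norm (ip (x m - x n) (y m)) + norm (ip (x n) (y m - y n))"
        by (simp add: dist_norm norm_triangle_ineq)
      also have "\<dots> \<le> nrm (x m - x n) * nrm (y m) + nrm (x n) * nrm (y m - y n)"
        by (intro add_mono cauchy_schwarz) simp_all
      also have "\<dots> \<le> nrm (x m - x n) * C + B * nrm (y m - y n)"
        using that N by (intro add_mono mult_left_mono mult_right_mono) (auto simp: nrm_nonneg)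
      also have "\<dots> < e / (2 * C) * C + B * (e / (2 * B))"
        using that B C by (intro add_strict_mono mult_strict_left_mono mult_strict_right_mono N1 N2) auto
      also have "\<dots> = e" using B C by simp
      finally show ?thesis .
    qed
    then show "\<exists>N. \<forall>m\<ge>N. \<forall>n\<ge>N. dist (ip (x m) (y m)) (ip (x n) (y n)) < e"
      by blast
  qed
  then show ?thesis by (rule Cauchy_convergent)
qed

lemma l2_rep_L2:
  assumes "\<xi> \<in> L2 E M"
  shows "l2_rep \<xi> \<in> l2_cauchy E M"
proof -
  obtain x where x: "x \<in> l2_cauchy E M" "\<xi> = l2_rel E M `` {x}"
    using assms by (auto simp: L2_def elim: quotientE)
  have "x \<in> \<xi>"
    using x by (auto simp: l2_rel_def l2_cauchy_def module_norm_def module_inner_def)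
  then have "l2_rep \<xi> \<in> \<xi>"
    unfolding l2_rep_def by (metis someI)
  then show ?thesis using x by (auto simp: l2_rel_def)
qed

text \<open>The chosen representative of the class of \<open>a\<close> need not be the constant
  sequence; it is only known to approach \<open>a\<close> in the module norm.\<close>

lemma l2_rep_embed:
  assumes a: "a \<in> M"
  shows "l2_rep (l2_embed E M a) \<in> l2_cauchy E M"
    and "(\<lambda>n. nrm (a - l2_rep (l2_embed E M a) n)) \<longlonglongrightarrow> 0"
proof -
  have "(\<lambda>n. a) \<in> l2_embed E M a"
    using a by (auto simp: l2_embed_def l2_rel_def l2_cauchy_def module_norm_def module_inner_def)
  then have "l2_rep (l2_embed E M a) \<in> l2_embed E M a"
    unfolding l2_rep_def by (metis someI)
  then show "l2_rep (l2_embed E M a) \<in> l2_cauchy E M"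
    "(\<lambda>n. nrm (a - l2_rep (l2_embed E M a) n)) \<longlonglongrightarrow> 0"
    by (auto simp: l2_embed_def l2_rel_def)
qed

lemma l2_inner_limit:
  assumes "l2_rep \<xi> \<in> l2_cauchy E M" "l2_rep \<eta> \<in> l2_cauchy E M"
  shows "(\<lambda>n. ip (l2_rep \<xi> n) (l2_rep \<eta> n)) \<longlonglongrightarrow> l2_inner E \<xi> \<eta>"
  using convergent_ip[OF assms] by (simp add: l2_inner_def convergent_LIMSEQ_iff)

lemma nrm_l2_rep_embed:
  assumes a: "a \<in> M"
  shows "(\<lambda>n. nrm (l2_rep (l2_embed E M a) n)) \<longlonglongrightarrow> nrm a"
proof -
  define x where "x = l2_rep (l2_embed E M a)"
  have x: "x n \<in> M" for n
    using l2_rep_embed(1)[OF a] by (simp add: x_def l2_cauchyD)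
  have sym: "nrm (x n - a) = nrm (a - x n)" for n
    using a x[of n] by (simp add: module_norm_def ip_diff_left ip_diff_right algebra_simps)
  have "norm (nrm (x n) - nrm a) \<le> nrm (a - x n)" for n
    using nrm_triangle_diff[OF x a, of n] nrm_triangle_diff[OF a x, of n] by (simp add: sym abs_le_iff)
  then have "\<forall>\<^sub>F n in sequentially. norm (nrm (x n) - nrm a) \<le> nrm (a - x n)"
    by (intro always_eventually allI)
  then have "(\<lambda>n. nrm (x n) - nrm a) \<longlonglongrightarrow> 0"
    by (rule Lim_null_comparison) (use l2_rep_embed(2)[OF a] in \<open>simp add: x_def\<close>)
  then show ?thesis by (simp add: x_def LIM_zero_iff)
qed

text \<open>The inequality in \<open>M\<close> passes to the limit along representatives. It is
  squared because \<open>norm (ip (x n) (x n))\<close> converges to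
  \<open>norm (l2_inner E \<xi> \<xi>)\<close> directly.\<close>

lemma l2_cauchy_schwarz:
  assumes \<xi>: "\<xi> \<in> L2 E M" and a: "a \<in> M"
  shows "(norm (l2_inner E \<xi> (l2_embed E M a)))\<^sup>2 \<le> norm (l2_inner E \<xi> \<xi>) * norm (ip a a)"
proof -
  define x where "x = l2_rep \<xi>"
  define y where "y = l2_rep (l2_embed E M a)"
  have xc: "x \<in> l2_cauchy E M" and yc: "y \<in> l2_cauchy E M"
    using l2_rep_L2[OF \<xi>] l2_rep_embed(1)[OF a] by (simp_all add: x_def y_def)
  have le: "(norm (ip (x n) (y n)))\<^sup>2 \<le> norm (ip (x n) (x n)) * (nrm (y n))\<^sup>2" for n
  proof -
    have "(norm (ip (x n) (y n)))\<^sup>2 \<le> (nrm (x n) * nrm (y n))\<^sup>2"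
      by (intro power_mono cauchy_schwarz l2_cauchyD(1)[OF xc] l2_cauchyD(1)[OF yc]) simp
    then show ?thesis by (simp add: power_mult_distrib nrm_power2)
  qed
  have "(\<lambda>n. (norm (ip (x n) (y n)))\<^sup>2) \<longlonglongrightarrow> (norm (l2_inner E \<xi> (l2_embed E M a)))\<^sup>2"
    using l2_inner_limit[of \<xi> "l2_embed E M a"] xc yc
    by (intro tendsto_intros) (simp_all add: x_def y_def)
  moreover have "(\<lambda>n. norm (ip (x n) (x n)) * (nrm (y n))\<^sup>2)
      \<longlonglongrightarrow> norm (l2_inner E \<xi> \<xi>) * (nrm a)\<^sup>2"
    using l2_inner_limit[of \<xi> \<xi>] xc nrm_l2_rep_embed[OF a]
    by (intro tendsto_intros) (simp_all add: x_def y_def)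
  ultimately show ?thesis
    using le by (auto simp flip: nrm_power2 intro: LIMSEQ_le)
qed

text \<open>Complex linearity, symmetry and nonnegativity of the form survive pointwise limits. Both
  conclusions are needed to turn an order bound on \<open>l2_inner E \<xi> \<xi>\<close> into a norm
  bound.\<close>

lemma l2_inner_self:
  assumes \<xi>: "\<xi> \<in> L2 E M"
  shows "l2_inner E \<xi> \<xi> \<in> bounded_operators" and "positive_op (l2_inner E \<xi> \<xi>)"
proof -
  define x where "x = l2_rep \<xi>"
  have x: "x n \<in> M" for n
    using l2_rep_L2[OF \<xi>] by (simp add: x_def l2_cauchyD)
  have ap: "(\<lambda>n. blinfun_apply (ip (x n) (x n)) v) \<longlonglongrightarrow> blinfun_apply (l2_inner E \<xi> \<xi>) v" for v
    using l2_inner_limit[of \<xi> \<xi>] l2_rep_L2[OF \<xi>] unfolding x_def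
    by (intro blinfun.tendsto tendsto_const) auto
  have "blinfun_apply (l2_inner E \<xi> \<xi>) (c *\<^sub>C v) = c *\<^sub>C blinfun_apply (l2_inner E \<xi> \<xi>) v" for c v
  proof (rule LIMSEQ_unique)
    show "(\<lambda>n. c *\<^sub>C blinfun_apply (ip (x n) (x n)) v) \<longlonglongrightarrow> c *\<^sub>C blinfun_apply (l2_inner E \<xi> \<xi>) v"
      by (rule bounded_linear.tendsto[OF bounded_linear_scaleC ap])
    have "ip (x n) (x n) \<in> bounded_operators" for n
      using x by simp
    then show "(\<lambda>n. c *\<^sub>C blinfun_apply (ip (x n) (x n)) v) \<longlonglongrightarrow> blinfun_apply (l2_inner E \<xi> \<xi>) (c *\<^sub>C v)"
      using ap[of "c *\<^sub>C v"] by (simp add: bounded_operators_scaleC)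
  qed
  then show bo: "l2_inner E \<xi> \<xi> \<in> bounded_operators"
    by (simp add: bounded_operators_def)
  show "positive_op (l2_inner E \<xi> \<xi>)"
  proof (rule positive_opI[OF bo])
    show "0 \<le> inner v (blinfun_apply (l2_inner E \<xi> \<xi>) v)" for v
    proof (rule LIMSEQ_le_const)
      show "(\<lambda>n. inner v (blinfun_apply (ip (x n) (x n)) v)) \<longlonglongrightarrow> inner v (blinfun_apply (l2_inner E \<xi> \<xi>) v)"
        by (intro tendsto_intros ap)
      show "\<exists>N. \<forall>n\<ge>N. 0 \<le> inner v (blinfun_apply (ip (x n) (x n)) v)"
        using positive_opD[OF ip_positive[OF x]] by blast
    qed
    show "adj (l2_inner E \<xi> \<xi>) = l2_inner E \<xi> \<xi>"
    proof (rule adj_eqI[OF bo])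
      fix v w
      have "inner (blinfun_apply (ip (x n) (x n)) v) w = inner v (blinfun_apply (ip (x n) (x n)) w)" for n
        using inner_adj[of "ip (x n) (x n)" v w] x by (simp add: adj_ip)
      moreover have "(\<lambda>n. inner (blinfun_apply (ip (x n) (x n)) v) w) \<longlonglongrightarrow> inner (blinfun_apply (l2_inner E \<xi> \<xi>) v) w"
        "(\<lambda>n. inner v (blinfun_apply (ip (x n) (x n)) w)) \<longlonglongrightarrow> inner v (blinfun_apply (l2_inner E \<xi> \<xi>) w)"
        by (intro tendsto_intros ap)+
      ultimately show "inner (blinfun_apply (l2_inner E \<xi> \<xi>) v) w = inner v (blinfun_apply (l2_inner E \<xi> \<xi>) w)"
        using LIMSEQ_unique by (metis (no_types, lifting) ext)
    qed
  qed
qed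

end

section \<open>The pairing of free difference quotients with $1 \otimes 1$\<close>

text \<open>The additive extension of \<open>g\<close> to the free abelian group, integers acting as
  real scalars. \<open>poly_eval\<close> is of this form, and \<open>tensor_inner\<close> is a
  nested instance.\<close>

definition frag_sum :: "('a \<Rightarrow> 'v::real_vector) \<Rightarrow> ('a \<Rightarrow>\<^sub>0 int) \<Rightarrow> 'v"
  where "frag_sum g f =
    (\<Sum>w\<in>Poly_Mapping.keys f. real_of_int (Poly_Mapping.lookup f w) *\<^sub>R g w)"

lemma frag_sum_superset:
  assumes "finite S" "Poly_Mapping.keys f \<subseteq> S"
  shows "frag_sum g f = (\<Sum>w\<in>S. real_of_int (Poly_Mapping.lookup f w) *\<^sub>R g w)"
  unfolding frag_sum_def using assms
  by (intro sum.mono_neutral_left) (auto simp: in_keys_iff)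

lemma frag_sum_zero [simp]: "frag_sum g 0 = 0"
  by (simp add: frag_sum_def)

lemma frag_sum_diff: "frag_sum g (a - b) = frag_sum g a - frag_sum g b"
proof -
  have "Poly_Mapping.keys (a - b) \<subseteq> Poly_Mapping.keys a \<union> Poly_Mapping.keys b"
    by (rule keys_diff)
  then show ?thesis
    by (simp add: frag_sum_superset[of "Poly_Mapping.keys a \<union> Poly_Mapping.keys b"]
        lookup_minus scaleR_diff_left sum_subtractf)
qed

lemma frag_sum_add: "frag_sum g (a + b) = frag_sum g a + frag_sum g b"
  using frag_sum_diff[of g "a + b" b] by simp

lemma frag_sum_of [simp]: "frag_sum g (frag_of w) = g w"
  by (simp add: frag_sum_def keys_frag_of)

lemma frag_sum_sum: "frag_sum g (sum h I) = (\<Sum>i\<in>I. frag_sum g (h i))"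
  by (induction I rule: infinite_finite_induct) (simp_all add: frag_sum_add)

lemma frag_sum_extend: "frag_sum g (frag_extend h f) = frag_sum (\<lambda>w. frag_sum g (h w)) f"
proof -
  have "Poly_Mapping.keys f \<subseteq> UNIV" by simp
  then show ?thesis
    by (induction f rule: frag_induction) (simp_all add: frag_extend_diff frag_sum_diff)
qed

lemma frag_sum_eq_0: "(\<And>w. w \<in> Poly_Mapping.keys f \<Longrightarrow> g w = 0) \<Longrightarrow> frag_sum g f = 0"
  by (simp add: frag_sum_def)

lemma frag_sum_swap:
  "frag_sum (\<lambda>z. frag_sum (\<lambda>w. g z w) t) s = frag_sum (\<lambda>w. frag_sum (\<lambda>z. g z w) s) t"
  unfolding frag_sum_def
  by (simp add: scaleR_sum_right mult.commute) (rule sum.swap)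

text \<open>The kernel of an additive map is a subgroup, so a map descends to a quotient once the
  generating relations are checked.\<close>

lemma frag_sum_hull_eq_0:
  assumes "f \<in> additive_subgroup hull G" and "\<And>x. x \<in> G \<Longrightarrow> frag_sum g x = 0"
  shows "frag_sum g f = 0"
  using assms by (rule hull_induct) (simp_all add: additive_subgroup_def frag_sum_diff)

lemma additive_subgroup_hull: "additive_subgroup (additive_subgroup hull G)"
  by (rule hull_in) (auto simp: additive_subgroup_def)

section \<open>The generated algebra and the evaluation of monomials\<close>

lemma unital_star_algebra_adjoin: "unital_star_algebra (adjoin B X)"
  unfolding adjoin_def by (rule hull_in) (auto simp: unital_star_algebra_def)

lemma adjoin_superset: "B \<subseteq> adjoin B X" "X \<in> adjoin B X"
  unfolding adjoin_def using hull_subset[of "insert X B" unital_star_algebra] by auto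

lemma adjoin_subset: "unital_star_algebra M \<Longrightarrow> B \<subseteq> M \<Longrightarrow> X \<in> M \<Longrightarrow> adjoin B X \<subseteq> M"
  unfolding adjoin_def by (rule hull_minimal) auto

lemma monomial_eval_Cons: "w \<noteq> [] \<Longrightarrow> monomial_eval X (b # w) = b o\<^sub>L X o\<^sub>L monomial_eval X w"
  by (cases w) auto

lemma monomial_eval_in_algebra:
  assumes A: "unital_star_algebra A" and X: "X \<in> A" and "w \<in> lists A"
  shows "monomial_eval X w \<in> A"
  using \<open>w \<in> lists A\<close>
proof (induction w)
  case (Cons b w)
  then show ?case
    using A X by (cases "w = []") (auto simp: monomial_eval_Cons unital_star_algebra_def)
qed (use A in \<open>auto simp: unital_star_algebra_def\<close>)

lemma monomial_eval_add:
  "monomial_eval X (u @ [x + y] @ v) = monomial_eval X (u @ [x] @ v) + monomial_eval X (u @ [y] @ v)"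
proof (induction u)
  case Nil
  then show ?case
    by (cases "v = []") (simp_all add: monomial_eval_Cons compose_add_left)
qed (simp add: monomial_eval_Cons compose_add_right)

text \<open>The scalar is pulled out to the left, through \<open>X\<close> and the entries of
  \<open>u\<close>; these are the operators required to be complex-linear.\<close>

lemma monomial_eval_scaleC:
  assumes "u \<in> lists bounded_operators" and X: "X \<in> bounded_operators"
  shows "monomial_eval X (u @ [c *\<^sub>C x] @ v) = c *\<^sub>C monomial_eval X (u @ [x] @ v)"
  using assms(1)
proof (induction u)
  case Nil
  then show ?case
    by (cases "v = []") (simp_all add: monomial_eval_Cons compose_scaleC_left)
next
  case (Cons b u)
  then have "b o\<^sub>L X \<in> bounded_operators"
    using X by (simp add: bounded_operators_compose)
  with Cons show ?case
    by (simp add: monomial_eval_Cons compose_scaleC_right)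
qed

lemma lists_take_drop: "w \<in> lists S \<Longrightarrow> take j w \<in> lists S" "w \<in> lists S \<Longrightarrow> drop j w \<in> lists S"
  by (auto dest: in_set_takeD in_set_dropD)

lemma take_drop_around:
  assumes "\<not> j \<le> length u"
  shows "take j (u @ [x] @ v) = u @ [x] @ take (j - length u - 1) v"
    "drop j (u @ [x] @ v) = drop (j - length u - 1) v"
  using assms by (simp_all add: take_Cons' drop_Cons')

section \<open>Pairings on the tensor square and on formal polynomials\<close>

context expectation
begin

text \<open>The form behind \<open>tensor_inner\<close>, before cosets; as a nested
  \<open>frag_sum\<close> it is additive in each argument.\<close>

definition tensor_pairing where
  "tensor_pairing s t =
    frag_sum (\<lambda>z. frag_sum (\<lambda>w. E (adj (snd z) o\<^sub>L E (adj (fst z) o\<^sub>L fst w) o\<^sub>L snd w)) t) s"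

text \<open>Additivity of \<open>E\<close> settles the first two kinds of relations. For the
  balancing relation, bimodularity releases \<open>d\<close> from the inner expectation, and it
  moves on to the second factor.\<close>

lemma tensor_pairing_null_right:
  assumes "A \<subseteq> M" "Poly_Mapping.keys s \<subseteq> M \<times> M" "n \<in> tensor_null D A"
  shows "tensor_pairing s n = 0"
  unfolding tensor_pairing_def
proof (rule frag_sum_eq_0)
  fix z assume "z \<in> Poly_Mapping.keys s"
  with assms obtain p q where z: "z = (p, q)" "p \<in> M" "q \<in> M" by blast
  have [simp]: "a \<in> A \<Longrightarrow> a \<in> M" for a using assms by auto
  show "frag_sum (\<lambda>w. E (adj (snd z) o\<^sub>L E (adj (fst z) o\<^sub>L fst w) o\<^sub>L snd w)) n = 0"
    using assms(3) unfolding tensor_null_def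
  proof (rule frag_sum_hull_eq_0, elim UnE CollectE exE conjE, goal_cases)
    case (3 _ x y d)
    have "E (adj p o\<^sub>L (x o\<^sub>L d)) = E (adj p o\<^sub>L x) o\<^sub>L d"
      using 3 z by (simp add: E_compose_right flip: compose_assoc)
    with 3 z show ?case by (simp add: frag_sum_diff compose_assoc)
  qed (use z in \<open>simp_all add: frag_sum_diff compose_add_left compose_add_right E_add\<close>)
qed

lemma tensor_pairing_null_left:
  assumes "A \<subseteq> M" "Poly_Mapping.keys t \<subseteq> M \<times> M" "n \<in> tensor_null D A"
  shows "tensor_pairing n t = 0"
  unfolding tensor_pairing_def frag_sum_swap[of _ t n]
proof (rule frag_sum_eq_0)
  fix w assume "w \<in> Poly_Mapping.keys t"
  with assms obtain p q where w: "w = (p, q)" "p \<in> M" "q \<in> M" by blast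
  have [simp]: "a \<in> A \<Longrightarrow> a \<in> M" for a using assms by auto
  show "frag_sum (\<lambda>z. E (adj (snd z) o\<^sub>L E (adj (fst z) o\<^sub>L fst w) o\<^sub>L snd w)) n = 0"
    using assms(3) unfolding tensor_null_def
  proof (rule frag_sum_hull_eq_0, elim UnE CollectE exE conjE, goal_cases)
    case (3 _ x y d)
    \<comment> \<open>In the conjugate-linear argument \<open>adj d\<close> leaves on the left and
      joins \<open>adj y\<close>.\<close>
    have "E (adj (x o\<^sub>L d) o\<^sub>L p) = adj d o\<^sub>L E (adj x o\<^sub>L p)"
      using 3 w by (simp add: adj_compose compose_assoc E_compose_left)
    with 3 w show ?case by (simp add: frag_sum_diff adj_compose compose_assoc)
  qed (use w in \<open>simp_all add: frag_sum_diff compose_add_left compose_add_right E_add adj_add\<close>)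
qed

text \<open>The laws of \<open>E\<close> hold only on \<open>M\<close>, so the entries of an
  arbitrary representative of a class have to be located.\<close>

lemma keys_tensor_null:
  assumes A: "unital_star_algebra A" "D \<subseteq> A" and "n \<in> tensor_null D A"
  shows "Poly_Mapping.keys n \<subseteq> A \<times> A"
  using assms(3) unfolding tensor_null_def
proof (rule hull_induct, goal_cases)
  case (1 n)
  then show ?case
    using A by (elim UnE CollectE exE conjE)
      (auto simp: keys_frag_of unital_star_algebra_def dest!: subsetD[OF keys_diff])
next
  case 2
  then show ?case
    by (auto simp: additive_subgroup_def dest!: subsetD[OF keys_diff])
qed

lemma tensor_class_some:
  "(SOME t. t \<in> tensor_class D A s) - s \<in> tensor_null D A"
proof -
  have "s \<in> tensor_class D A s"
    using additive_subgroup_hull by (auto simp: tensor_class_def tensor_null_def additive_subgroup_def)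
  then have "(SOME t. t \<in> tensor_class D A s) \<in> tensor_class D A s"
    by (metis someI)
  then show ?thesis by (simp add: tensor_class_def)
qed

text \<open>The chosen representatives are exchanged one at a time: first \<open>s'\<close> for
  \<open>s\<close> against the chosen \<open>t'\<close>, which requires control of the entries of
  \<open>t'\<close>, then \<open>t'\<close> for \<open>t\<close> against the given
  \<open>s\<close>.\<close>

lemma tensor_inner_class:
  assumes A: "unital_star_algebra A" "D \<subseteq> A" "A \<subseteq> M"
    and s: "Poly_Mapping.keys s \<subseteq> A \<times> A" and t: "Poly_Mapping.keys t \<subseteq> A \<times> A"
  shows "tensor_inner E (tensor_class D A s) (tensor_class D A t) = tensor_pairing s t"
proof -
  define s' where "s' = (SOME t. t \<in> tensor_class D A s)"
  define t' where "t' = (SOME u. u \<in> tensor_class D A t)"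
  have s': "s' - s \<in> tensor_null D A" and t': "t' - t \<in> tensor_null D A"
    unfolding s'_def t'_def by (rule tensor_class_some)+
  have AM: "A \<times> A \<subseteq> M \<times> M" using A by auto
  have "Poly_Mapping.keys ((t' - t) + t) \<subseteq> A \<times> A"
    using keys_tensor_null[OF A(1,2) t'] t
    by (intro order_trans[OF keys_add]) simp
  then have keys_t': "Poly_Mapping.keys t' \<subseteq> M \<times> M"
    using AM by simp
  have "tensor_inner E (tensor_class D A s) (tensor_class D A t) = tensor_pairing s' t'"
    unfolding tensor_inner_def Let_def s'_def[symmetric] t'_def[symmetric] tensor_pairing_def
      frag_sum_def
    by (simp add: case_prod_unfold scaleR_sum_right)
  also have "\<dots> = tensor_pairing s t'"
    using tensor_pairing_null_left[OF A(3) keys_t' s']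
    by (simp add: tensor_pairing_def frag_sum_diff)
  also have "\<dots> = tensor_pairing s t"
    using tensor_pairing_null_right[OF A(3) order_trans[OF s AM] t']
    unfolding tensor_pairing_def frag_sum_swap[of _ _ s]
    by (simp add: frag_sum_diff)
  finally show ?thesis .
qed

text \<open>\<open>cut_pairing X w j\<close> is the pairing of \<open>1 \<otimes> 1\<close> with the \<open>j\<close>-th term of \<open>monomial_diff X w\<close>.\<close>

definition cut_pairing where
  "cut_pairing X w j = E (E (monomial_eval X (take j w)) o\<^sub>L monomial_eval X (drop j w))"

lemma monomial_eval_in_M: "X \<in> M \<Longrightarrow> w \<in> lists M \<Longrightarrow> monomial_eval X w \<in> M"
  by (rule monomial_eval_in_algebra[OF von_neumann_algebra_unital_star_algebra[OF M]])

text \<open>A cut falls between two coefficients, so the split coefficient lies wholly in the right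
  piece (\<open>j \<le> length u\<close>) or wholly in the left one, and additivity of evaluation on
  that piece suffices.\<close>

lemma cut_pairing_add:
  assumes [simp]: "X \<in> M" "x \<in> M" "y \<in> M" and uv: "u \<in> lists M" "v \<in> lists M"
  shows "cut_pairing X (u @ [x + y] @ v) j =
    cut_pairing X (u @ [x] @ v) j + cut_pairing X (u @ [y] @ v) j"
proof (cases "j \<le> length u")
  case True
  have "monomial_eval X (take j u) \<in> M"
    using uv by (auto intro!: monomial_eval_in_M dest!: in_set_takeD)
  moreover have "monomial_eval X (drop j u @ [a] @ v) \<in> M" if "a \<in> M" for a
    using uv that by (auto intro!: monomial_eval_in_M dest!: in_set_dropD)
  ultimately show ?thesis
    using True unfolding cut_pairing_def take_append drop_append
    by (simp add: monomial_eval_add[simplified] compose_add_right E_add)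
next
  case False
  have "monomial_eval X (drop k v) \<in> M" for k
    using uv by (auto intro!: monomial_eval_in_M dest!: in_set_dropD)
  moreover have "monomial_eval X (u @ [a] @ take k v) \<in> M" if "a \<in> M" for a k
    using uv that by (auto intro!: monomial_eval_in_M dest!: in_set_takeD)
  ultimately show ?thesis
    unfolding cut_pairing_def take_drop_around[OF False] monomial_eval_add
    by (simp add: compose_add_left E_add)
qed

lemma cut_pairing_scaleC:
  assumes [simp]: "X \<in> M" "x \<in> M" and uv: "u \<in> lists M" "v \<in> lists M"
  shows "cut_pairing X (u @ [c *\<^sub>C x] @ v) j = c *\<^sub>C cut_pairing X (u @ [x] @ v) j"
proof (cases "j \<le> length u")
  case True
  have u: "drop j u \<in> lists bounded_operators"
    using uv(1) by (auto dest!: in_set_dropD)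
  have "monomial_eval X (take j u) \<in> M" and "monomial_eval X (drop j u @ [x] @ v) \<in> M"
    using uv by (auto intro!: monomial_eval_in_M dest!: in_set_takeD in_set_dropD)
  then show ?thesis
    using True unfolding cut_pairing_def take_append drop_append
    by (simp add: monomial_eval_scaleC[OF u, simplified] compose_scaleC_right E_scaleC)
next
  case False
  have u: "u \<in> lists bounded_operators"
    using uv(1) by auto
  have "monomial_eval X (drop k v) \<in> M" and "monomial_eval X (u @ [x] @ take k v) \<in> M" for k
    using uv by (auto intro!: monomial_eval_in_M dest!: in_set_takeD in_set_dropD)
  then show ?thesis
    unfolding cut_pairing_def take_drop_around[OF False]
    by (simp add: monomial_eval_scaleC[OF u, simplified] compose_scaleC_left E_scaleC)
qed

text \<open>The pairing of 1 \<otimes> 1 with \<partial>w. Each inner cut of \<open>w\<close>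
  removes one occurrence of the indeterminate, whence the range of \<open>j\<close>.\<close>

definition diff_pairing where
  "diff_pairing X w = (\<Sum>j = 1..<length w. cut_pairing X w j)"

lemma tensor_pairing_one_diff:
  "tensor_pairing (frag_of (id_blinfun, id_blinfun)) (frag_extend (monomial_diff X) f) =
    frag_sum (diff_pairing X) f"
  by (simp add: tensor_pairing_def adj_id frag_sum_extend monomial_diff_def frag_sum_sum
      diff_pairing_def[abs_def] cut_pairing_def)

lemma diff_pairing_poly_null:
  assumes X: "X \<in> M" and B: "B \<subseteq> M" and f: "f \<in> poly_null B"
  shows "frag_sum (diff_pairing X) f = 0"
  using f unfolding poly_null_def
proof (rule frag_sum_hull_eq_0, elim UnE CollectE exE conjE, goal_cases)
  case (1 _ u v x y)
  then have "u \<in> lists M" "v \<in> lists M" "x \<in> M" "y \<in> M"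
    using B by auto
  then show ?case
    using cut_pairing_add[OF X] 1
    by (simp add: frag_sum_diff diff_pairing_def sum.distrib)
next
  case (2 _ u v c x y)
  then have w: "u \<in> lists M" "v \<in> lists M" "x \<in> M" "y \<in> M"
    using B by auto
  \<comment> \<open>Both sides are \<open>c\<close> times the value for
    \<open>u @ [x, y] @ v\<close>, even at the cut separating \<open>x\<close> from
    \<open>y\<close>.\<close>
  have "cut_pairing X (u @ [c *\<^sub>C x, y] @ v) j = cut_pairing X (u @ [x, c *\<^sub>C y] @ v) j" for j
    using cut_pairing_scaleC[OF X, of x u "y # v" c j] cut_pairing_scaleC[OF X, of y "u @ [x]" v c j] w
    by simp
  then show ?case
    using 2 by (simp add: frag_sum_diff diff_pairing_def)
qed

text \<open>The chosen polynomial \<open>f\<close> is compared with the monomial \<open>?w\<close>,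
  which also evaluates to \<open>X\<close>; by freeness the two differ by relations, on which the
  pairing vanishes.\<close>

lemma tensor_inner_one_free_diff_quotient:
  assumes "X \<in> M" "D \<subseteq> B" "B \<subseteq> M" and free: "algebraically_free B X"
  shows "tensor_inner E (tensor_class D (adjoin B X) (frag_of (id_blinfun, id_blinfun)))
      (free_diff_quotient D B X X) = id_blinfun"
proof -
  let ?A = "adjoin B X"
  let ?w = "[id_blinfun, id_blinfun]"
  define f where "f = (SOME f. f \<in> formal_polys B \<and> poly_eval X f = X)"
  have idB: "id_blinfun \<in> B" using assms by auto
  have A: "unital_star_algebra ?A" "D \<subseteq> ?A" "?A \<subseteq> M"
    using assms adjoin_superset(1)[of B X] von_neumann_algebra_unital_star_algebra[OF M]
      unital_star_algebra_adjoin adjoin_subset[of M B X] by auto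
  have eval: "poly_eval X = frag_sum (monomial_eval X)"
    by (simp add: fun_eq_iff poly_eval_def frag_sum_def)
  have w: "frag_of ?w \<in> formal_polys B" "poly_eval X (frag_of ?w) = X"
    using idB by (simp_all add: formal_polys_def keys_frag_of eval)
  then have f: "f \<in> formal_polys B" "poly_eval X f = X"
    unfolding f_def using someI_ex[of "\<lambda>f. f \<in> formal_polys B \<and> poly_eval X f = X"] by blast+
  have "f - frag_of ?w \<in> formal_polys B"
    using f(1) w(1) keys_diff[of f "frag_of ?w"]
    unfolding formal_polys_def mem_Collect_eq by blast
  moreover have "poly_eval X (f - frag_of ?w) = 0"
    using f(2) w(2) by (simp add: eval frag_sum_diff)
  ultimately have "f - frag_of ?w \<in> poly_null B"
    using free by (simp add: algebraically_free_def)
  then have "frag_sum (diff_pairing X) (f - frag_of ?w) = 0"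
    using assms by (intro diff_pairing_poly_null)
  \<comment> \<open>The only cut is at \<open>j = 1\<close>, with both pieces equal to the
    identity.\<close>
  moreover have "diff_pairing X ?w = id_blinfun"
    by (simp add: diff_pairing_def cut_pairing_def E_D numeral_2_eq_2)
  ultimately have sum: "frag_sum (diff_pairing X) f = id_blinfun"
    by (simp add: frag_sum_diff)
  have "Poly_Mapping.keys (monomial_diff X w) \<subseteq> ?A \<times> ?A" if "w \<in> Poly_Mapping.keys f" for w
  proof -
    have w: "w \<in> lists ?A"
      using that f(1) adjoin_superset(1)[of B X] by (auto simp: formal_polys_def)
    have "Poly_Mapping.keys (monomial_diff X w) \<subseteq>
        (\<Union>j\<in>{1..<length w}. {(monomial_eval X (take j w), monomial_eval X (drop j w))})"
      unfolding monomial_diff_def by (rule order_trans[OF keys_sum]) (simp add: keys_frag_of)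
    also have "\<dots> \<subseteq> ?A \<times> ?A"
      using monomial_eval_in_algebra[OF A(1) adjoin_superset(2)] lists_take_drop[OF w] by blast
    finally show ?thesis .
  qed
  then have "Poly_Mapping.keys (frag_extend (monomial_diff X) f) \<subseteq> ?A \<times> ?A"
    by (intro order_trans[OF keys_frag_extend]) blast
  moreover have "id_blinfun \<in> ?A" using A(1) by (simp add: unital_star_algebra_def)
  ultimately show ?thesis
    unfolding free_diff_quotient_def f_def[symmetric]
    by (subst tensor_inner_class[OF A]) (simp_all add: keys_frag_of tensor_pairing_one_diff sum)
qed

section \<open>The Fisher information bound and the optimal predictor\<close>

lemma fisher_information_bound:
  assumes nontrivial: "(id_blinfun :: 'h \<Rightarrow>\<^sub>L 'h) \<noteq> 0"
    and "D \<subseteq> B" "B \<subseteq> M" and X: "X \<in> M" and free: "algebraically_free B X"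
    and ex: "\<exists>J. is_conjugate_variable E M D B X J"
    and le: "free_fisher_information E M D B X \<preceq> K *\<^sub>R id_blinfun"
  shows "1 / K \<le> norm (ip X X)"
proof (cases "K > 0")
  case True
  define J where "J = conjugate_variable E M D B X"
  have J: "is_conjugate_variable E M D B X J"
    unfolding J_def conjugate_variable_def using ex by (rule someI_ex)
  have L2: "J \<in> L2 E M"
    using J by (simp add: is_conjugate_variable_def l2_closure_def)
  have "l2_inner E J (l2_embed E M X) = id_blinfun"
    using J adjoin_superset(2)[of X B] tensor_inner_one_free_diff_quotient[of X B] assms
    by (simp add: is_conjugate_variable_def)
  then have "(norm (id_blinfun :: 'h \<Rightarrow>\<^sub>L 'h))\<^sup>2 \<le> norm (l2_inner E J J) * norm (ip X X)"
    using l2_cauchy_schwarz[OF L2 X] by simp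
  \<comment> \<open>Submultiplicativity gives \<open>n \<le> n * n\<close> for the norm
    \<open>n\<close> of the identity, which is nonzero because the space is nontrivial.\<close>
  moreover have "1 \<le> norm (id_blinfun :: 'h \<Rightarrow>\<^sub>L 'h)"
    using norm_blinfun_compose[of "id_blinfun :: 'h \<Rightarrow>\<^sub>L 'h" id_blinfun] nontrivial by simp
  ultimately have "1 \<le> norm (l2_inner E J J) * norm (ip X X)"
    using one_le_power[of "norm (id_blinfun :: 'h \<Rightarrow>\<^sub>L 'h)" 2] by linarith
  moreover have "norm (l2_inner E J J) \<le> K"
  proof (rule positive_op_norm_le[OF l2_inner_self[OF L2]])
    fix v
    have "0 \<le> inner v (blinfun_apply (K *\<^sub>R id_blinfun - l2_inner E J J) v)"
      using le by (intro positive_opD) (simp add: op_le_def free_fisher_information_def J_def)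
    then show "inner v (blinfun_apply (l2_inner E J J) v) \<le> K * (norm v)\<^sup>2"
      by (simp add: blinfun.diff_left blinfun.scaleR_left inner_diff_right power2_norm_eq_inner)
  qed (use True in simp)
  ultimately have "1 \<le> K * norm (ip X X)"
    by (meson mult_right_mono norm_ge_zero order_trans)
  then show ?thesis
    using True by (simp add: divide_le_eq mult.commute)
next
  case False
  \<comment> \<open>This includes \<open>K = 0\<close>, where \<open>1 / K\<close> is 0 by
    convention.\<close>
  then have "1 / K \<le> 0" by (simp add: divide_nonpos_nonneg)
  then show ?thesis by (rule order_trans) simp
qed

text \<open>The cross terms vanish because \<open>c\<close> lies in \<open>D\<close>, so
  bimodularity reduces them to multiples of \<open>E X = 0\<close>. Adding the positive operator
  \<open>c o\<^sub>L c\<close> to the positive operator \<open>E (X o\<^sub>L X)\<close> cannot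
  lower the norm.\<close>

lemma MSE_ge:
  assumes R: "R \<in> M" "adj R = R" and A: "A \<in> self_adjoint_part D"
  shows "MSE E R (E R) \<le> MSE E R A"
proof -
  define X where "X = R - E R"
  define c where "c = E R - A"
  have [simp]: "A \<in> D" "adj A = A" using A by (auto simp: self_adjoint_part_def)
  have X [simp]: "X \<in> M" "adj X = X" and EX: "E X = 0"
    using R by (simp_all add: X_def adj_diff adj_E E_diff E_D)
  have c [simp]: "c \<in> D" "adj c = c"
    using R by (simp_all add: c_def adj_diff adj_E)
  have RA: "R - A = X + c" by (simp add: X_def c_def)
  have "E ((R - A) o\<^sub>L (R - A)) = E (X o\<^sub>L X) + (c o\<^sub>L c)"
    unfolding RA
    by (simp add: compose_add_left compose_add_right E_add E_compose_left E_compose_right EX E_D)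
  moreover have "norm (E (X o\<^sub>L X)) \<le> norm (E (X o\<^sub>L X) + (c o\<^sub>L c))"
  proof (rule positive_op_norm_le)
    show "positive_op (E (X o\<^sub>L X))"
      using ip_positive[of X] by (simp add: module_inner_def)
    fix v
    have "inner v (blinfun_apply (c o\<^sub>L c) v) \<ge> 0"
      using positive_opD[OF positive_op_adj_compose[of c], of v] by simp
    then show "inner v (blinfun_apply (E (X o\<^sub>L X)) v)
        \<le> norm (E (X o\<^sub>L X) + (c o\<^sub>L c)) * (norm v)\<^sup>2"
      using inner_apply_le_norm[of v "E (X o\<^sub>L X) + (c o\<^sub>L c)"]
      by (simp add: blinfun.add_left inner_add_right)
  qed simp_all
  ultimately show ?thesis
    by (simp add: MSE_def X_def)
qed

end

theorem theorem9p17: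
  fixes M D B :: "('h::chilbert_space \<Rightarrow>\<^sub>L 'h) set"
    and E :: "('h \<Rightarrow>\<^sub>L 'h) \<Rightarrow> ('h \<Rightarrow>\<^sub>L 'h)"
    and R X :: "'h \<Rightarrow>\<^sub>L 'h"
    and K :: real
  assumes nontrivial: "(id_blinfun :: 'h \<Rightarrow>\<^sub>L 'h) \<noteq> 0"
    and "von_neumann_algebra M" "von_neumann_algebra B" "von_neumann_algebra D"
    and "D \<subseteq> B" "B \<subseteq> M"
    and "conditional_expectation M D E" "faithful_map M E" "normal_map M D E"
    and "R \<in> M" "adj R = R"
    and "X = R - E R"
    and "algebraically_free B X"
    and "\<exists>J. is_conjugate_variable E M D B X J"
    and "free_fisher_information E M D B X \<preceq> K *\<^sub>R id_blinfun"
  shows "(\<forall>A\<in>self_adjoint_part D. MSE E R A \<ge> 1 / K) \<and>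
    E R \<in> self_adjoint_part D \<and>
    (INF A\<in>self_adjoint_part D. MSE E R A) = MSE E R (E R) \<and>
    MSE E R (E R) = norm (E (X o\<^sub>L X)) \<and>
    norm (E (X o\<^sub>L X)) \<ge> 1 / K"
proof -
  interpret expectation M D E
    by unfold_locales (use assms in auto)
  have X: "X \<in> M" "adj X = X"
    using assms by (simp_all add: adj_diff adj_E)
  have ER: "E R \<in> self_adjoint_part D"
    using assms by (simp add: self_adjoint_part_def adj_E)
  have MSE: "MSE E R (E R) = norm (E (X o\<^sub>L X))"
    using assms by (simp add: MSE_def)
  have bound: "1 / K \<le> norm (E (X o\<^sub>L X))"
    using fisher_information_bound[of B X K] assms X by (simp add: module_inner_def)
  have min: "MSE E R (E R) \<le> MSE E R A" if "A \<in> self_adjoint_part D" for A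
    using assms that by (intro MSE_ge)
  \<comment> \<open>The infimum is attained: \<open>min\<close> supplies the lower bound and
    \<open>E R\<close> is a member of the index set.\<close>
  have "(INF A\<in>self_adjoint_part D. MSE E R A) = MSE E R (E R)"
  proof (rule antisym)
    show "(INF A\<in>self_adjoint_part D. MSE E R A) \<le> MSE E R (E R)"
      using min by (intro cINF_lower bdd_belowI2 ER)
    show "MSE E R (E R) \<le> (INF A\<in>self_adjoint_part D. MSE E R A)"
      using min ER by (intro cINF_greatest) auto
  qed
  with ER MSE bound min show ?thesis
    by (auto intro: order_trans)
qed

end
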